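(* Let $S$ be a semigroup, $z_0\in S$ a fixed element, $\sigma:S\to S$ an involutive automorphism and $\lambda\in\mathbb{C}^{*}$. The solutions $f,g:S\to\mathbb{C}$ of the functional equation $$f(x\sigma(y)z_0)=f(x)g(y)-f(y)g(x)+\lambda g(x\sigma(y)z_0),\qquad x,y\in S,$$ can be listed as follows. (1) $f=\lambda g$ and $g$ is arbitrary. (2) $S\neq S^2z_0$, $g=0$ and $f$ is any non-zero function such that $f(S^2z_0)=0$. (3) $S\neq S^2z_0$, $f=\dfrac{1+\kappa\lambda}{\kappa}g$, where $g$ is any non-zero function such that $g(S^2z_0)=0$, and $\kappa\in\mathbb{C}^{*}$ is a constant. (4) There exist constants $\gamma,b\in\mathbb{C}^{*}$, $c\in\mathbb{C}\setminus\{\pm1\}$ and an exponential function $\chi$ on $S$ with $\chi\neq\chi\circ\sigma$, $\chi(z_0)=\dfrac{-2b}{1+c}$ and $\chi\circ\sigma(z_0)=\dfrac{2b}{1-c}$ such that $$f=\frac{\chi+\chi\circ\sigma}{2\gamma}+(2\gamma\lambda b+c)\,\frac{\chi-\chi\circ\sigma}{2\gamma}\quad\text{and}\quad g=b(\chi-\chi\circ\sigma).$$ (5) There exist constants $\beta,b\in\mathbb{C}^{*}$, $c\in\mathbb{C}$ and an exponential function $\chi$ on $S$ with $\chi\neq\chi\circ\sigma$ and $\chi(z_0)=\chi\circ\sigma(z_0)=1/\beta$ such that $$f=\lambda\,\frac{\chi+\chi\circ\sigma}{2\beta}+(2\beta b+\lambda c)\,\frac{\chi-\chi\circ\sigma}{2\beta}\quad\text{and}\quad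 g=\frac{\chi+\chi\circ\sigma}{2\beta}+c\,\frac{\chi-\chi\circ\sigma}{2\beta}.$$ (6) There exist constants $\alpha,\delta,b\in\mathbb{C}^{*}$, $c\in\mathbb{C}$ and an exponential function $\chi$ on $S$ with $\alpha\neq\pm(2b\delta+\alpha c)$, $\chi\neq\chi\circ\sigma$, $\chi(z_0)=\dfrac{2b}{\alpha(1+c)+2b\delta}$ and $\chi\circ\sigma(z_0)=\dfrac{2b}{\alpha(c-1)+2b\delta}$ such that $$f=(\alpha+\lambda)\,\frac{\chi+\chi\circ\sigma}{2\delta}+[c(\alpha+\lambda)+2b\delta]\,\frac{\chi-\chi\circ\sigma}{2\delta}\quad\text{and}\quad g=\frac{\chi+\chi\circ\sigma}{2\delta}+c\,\frac{\chi-\chi\circ\sigma}{2\delta}.$$ (7) There exist constants $\gamma,c\in\mathbb{C}^{*}$, an exponential function $\chi$ on $S$, a non-zero additive function $A:S\setminus I_\chi\to\mathbb{C}$ and a function $\rho:P_\chi\to\mathbb{C}$ with $\chi\circ\sigma=\chi$, $A\circ\sigma=-A$, $\rho\circ\sigma=-\rho$ and $\chi(z_0)=A(z_0)=\dfrac{-1}{c}$ such that $$f=\gamma\chi+(\gamma c+\lambda)\Psi_{A\chi,\rho}\quad\text{and}\quad g=\Psi_{A\chi,\rho}.$$ (8) There exist constants $\alpha,c\in\mathbb{C}$ and $\delta\in\mathbb{C}^{*}$, an exponential function $\chi$ on $S$, a non-zero additive function $A:S\setminus I_\chi\to\mathbb{C}$ and a function $\rho:P_\chi\to\mathbb{C}$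 with $\alpha c+\delta\neq0$, $\chi\circ\sigma=\chi$, $A\circ\sigma=-A$, $\rho\circ\sigma=-\rho$, $\chi(z_0)=\dfrac{1}{\alpha c+\delta}$ and $A(z_0)=-\dfrac{\alpha}{\alpha c+\delta}$ such that $$f=\frac{\alpha+\lambda}{\delta}\chi+\frac{c(\lambda+\alpha)+\delta}{\delta}\Psi_{A\chi,\rho}\quad\text{and}\quad g=\frac1\delta\left(\chi+c\,\Psi_{A\chi,\rho}\right).$$ Moreover, if $S$ is a topological semigroup and $f,g\in C(S)$, then $\chi,\chi\circ\sigma\in C(S)$, $A\in C(S\setminus I_\chi)$ and $\rho\in C(P_\chi)$.
   Context: A semigroup is a set with an associative composition rule. An involutive automorphism $\sigma:S\to S$ is a bijection with $\sigma(xy)=\sigma(x)\sigma(y)$ and $\sigma(\sigma(x))=x$ for all $x,y\in S$. $\mathbb{C}^{*}=\mathbb{C}\setminus\{0\}$. $S^2z_0:=\{xyz_0: x,y\in S\}$, and $f(S^2z_0)=0$ means that $f$ vanishes on this set. For a topological space $X$, $C(X)$ denotes the continuous functions $X\to\mathbb{C}$; subsets of $S$ carry the subspace topology. A function $\chi:S\to\mathbb{C}$ is multiplicative if $\chi(xy)=\chi(x)\chi(y)$ for all $x,y\in S$; it is an exponential if moreover $\chi\neq0$. For a subset $T\subseteq S$, $T^2:=\{xy: x,y\in T\}$. For an exponential $\chi$, the null space is $I_\chi:=\{x\in S:\chi(x)=0\}$; $S\setminus I_\chi$ is a subsemigroup of $S$. A function $A$ from a semigroup $T$ to $\mathbb{C}$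 is additive if $A(xy)=A(x)+A(y)$ for all $x,y\in T$. Define $$P_\chi:=\{p\in I_\chi\setminus I_\chi^2:\ up,\,pv,\,upv\in I_\chi\setminus I_\chi^2\ \text{for all } u,v\in S\setminus I_\chi\}.$$ If $\chi\circ\sigma=\chi$, then $\sigma$ maps each of $S\setminus I_\chi$, $P_\chi$ and $I_\chi\setminus P_\chi$ into itself. For an exponential $\chi:S\to\mathbb{C}$, an additive $A:S\setminus I_\chi\to\mathbb{C}$ and $\rho:P_\chi\to\mathbb{C}$, $\Psi_{A\chi,\rho}:S\to\mathbb{C}$ denotes the function $$\Psi_{A\chi,\rho}(x)=\begin{cases}A(x)\chi(x)& x\in S\setminus I_\chi,\\ \rho(x)& x\in P_\chi,\\ 0& x\in I_\chi\setminus P_\chi,\end{cases}$$ where it is part of the notation (i.e. required whenever $\Psi_{A\chi,\rho}$ is written) that the following two conditions hold: (i) $\Psi_{A\chi,\rho}(xy)=\Psi_{A\chi,\rho}(yx)=0$ for all $x\in I_\chi\setminus P_\chi$ and $y\in S\setminus I_\chi$; (ii) for all $p\in P_\chi$ and $u,v\in S\setminus I_\chi$ (so that $up,pv,upv\in P_\chi$), $\rho(up)=\rho(p)\chi(u)$, $\rho(pv)=\rho(p)\chi(v)$ and $\rho(upv)=\rho(p)\chi(uv)$.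
   Formalization: In (8), "a non-zero additive function A" is relaxed to "A and ρ not both zero": as printed, the list misses solutions with A = 0, α = 0, ρ ≠ 0 (e.g. S = {1,p,q,0} with all products of p, q zero, z₀ = 1, σ swapping p and q). *)

theory Defs
  imports "HOL-Analysis.Analysis"
begin

text \<open>
  The semigroup \<open>S\<close> is the universe of a type of class \<^class>\<open>semigroup_mult\<close>.  Functions defined only
  on a subset of \<open>S\<close> (additive functions on \<open>- null_space chi\<close>, functions \<open>\<rho>\<close> on \<open>P_set chi\<close>) are total functions
  whose values outside that subset are never used.
\<close>

definition involutive_automorphism :: "('a::semigroup_mult \<Rightarrow> 'a) \<Rightarrow> bool" where
  "involutive_automorphism \<sigma> \<longleftrightarrow>
     bij \<sigma> \<and> (\<forall>x y. \<sigma> (x * y) = \<sigma> x * \<sigma> y) \<and> (\<forall>x. \<sigma> (\<sigma> x) = x)"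

definition multiplicative :: "('a::semigroup_mult \<Rightarrow> complex) \<Rightarrow> bool" where
  "multiplicative chi \<longleftrightarrow> (\<forall>x y. chi (x * y) = chi x * chi y)"

definition exponential :: "('a::semigroup_mult \<Rightarrow> complex) \<Rightarrow> bool" where
  "exponential chi \<longleftrightarrow> multiplicative chi \<and> chi \<noteq> (\<lambda>x. 0)"

definition set_sq :: "'a::semigroup_mult set \<Rightarrow> 'a set" where
  "set_sq T = {x * y | x y. x \<in> T \<and> y \<in> T}"

definition S2z :: "'a::semigroup_mult \<Rightarrow> 'a set" where
  "S2z z\<^sub>0 = {x * y * z\<^sub>0 | x y. True}"

definition null_space :: "('a::semigroup_mult \<Rightarrow> complex) \<Rightarrow> 'a set" where
  "null_space chi = {x. chi x = 0}"

definition P_set :: "('a::semigroup_mult \<Rightarrow> complex) \<Rightarrow> 'a set" where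
  "P_set chi = {p \<in> null_space chi - set_sq (null_space chi).
     \<forall>u \<in> - null_space chi. \<forall>v \<in> - null_space chi.
       u * p \<in> null_space chi - set_sq (null_space chi) \<and>
       p * v \<in> null_space chi - set_sq (null_space chi) \<and>
       u * p * v \<in> null_space chi - set_sq (null_space chi)}"

definition additive_on :: "'a::semigroup_mult set \<Rightarrow> ('a \<Rightarrow> complex) \<Rightarrow> bool" where
  "additive_on T A \<longleftrightarrow> (\<forall>x \<in> T. \<forall>y \<in> T. A (x * y) = A x + A y)"

definition Psi ::
    "('a::semigroup_mult \<Rightarrow> complex) \<Rightarrow> ('a \<Rightarrow> complex) \<Rightarrow> ('a \<Rightarrow> complex) \<Rightarrow> 'a \<Rightarrow> complex" where
  "Psi chi A \<rho> x =
     (if x \<notin> null_space chi then A x * chi x else if x \<in> P_set chi then \<rho> x else 0)"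

text \<open>The requirements that are implicit whenever \<open>\<Psi>\<close> is written.\<close>

definition Psi_admissible ::
    "('a::semigroup_mult \<Rightarrow> complex) \<Rightarrow> ('a \<Rightarrow> complex) \<Rightarrow> ('a \<Rightarrow> complex) \<Rightarrow> bool" where
  "Psi_admissible chi A \<rho> \<longleftrightarrow>
     exponential chi \<and> additive_on (- null_space chi) A \<and>
     (\<forall>x \<in> null_space chi - P_set chi. \<forall>y \<in> - null_space chi.
        Psi chi A \<rho> (x * y) = 0 \<and> Psi chi A \<rho> (y * x) = 0) \<and>
     (\<forall>p \<in> P_set chi. \<forall>u \<in> - null_space chi. \<forall>v \<in> - null_space chi.
        \<rho> (u * p) = \<rho> p * chi u \<and> \<rho> (p * v) = \<rho> p * chi v \<and> \<rho> (u * p * v) = \<rho> p * chi (u * v))"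

text \<open>
  In the predicates below, \<open>l\<close> stands for the constant \<open>\<lambda>\<close> of the functional equation.
\<close>

definition solves ::
    "('a::semigroup_mult \<Rightarrow> 'a) \<Rightarrow> 'a \<Rightarrow> complex \<Rightarrow> ('a \<Rightarrow> complex) \<Rightarrow> ('a \<Rightarrow> complex) \<Rightarrow> bool" where
  "solves \<sigma> z\<^sub>0 l f g \<longleftrightarrow>
     (\<forall>x y. f (x * \<sigma> y * z\<^sub>0) = f x * g y - f y * g x + l * g (x * \<sigma> y * z\<^sub>0))"

definition family4 ::
    "('a::semigroup_mult \<Rightarrow> 'a) \<Rightarrow> 'a \<Rightarrow> complex \<Rightarrow> ('a \<Rightarrow> complex) \<Rightarrow> ('a \<Rightarrow> complex) \<Rightarrow>
     complex \<Rightarrow> complex \<Rightarrow> complex \<Rightarrow> ('a \<Rightarrow> complex) \<Rightarrow> bool" where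
  "family4 \<sigma> z\<^sub>0 l f g \<gamma> b c chi \<longleftrightarrow>
     \<gamma> \<noteq> 0 \<and> b \<noteq> 0 \<and> c \<noteq> 1 \<and> c \<noteq> -1 \<and>
     exponential chi \<and> chi \<noteq> chi \<circ> \<sigma> \<and>
     chi z\<^sub>0 = -2 * b / (1 + c) \<and> (chi \<circ> \<sigma>) z\<^sub>0 = 2 * b / (1 - c) \<and>
     f = (\<lambda>x. (chi x + (chi \<circ> \<sigma>) x) / (2 * \<gamma>)
            + (2 * \<gamma> * l * b + c) * ((chi x - (chi \<circ> \<sigma>) x) / (2 * \<gamma>))) \<and>
     g = (\<lambda>x. b * (chi x - (chi \<circ> \<sigma>) x))"

definition family5 ::
    "('a::semigroup_mult \<Rightarrow> 'a) \<Rightarrow> 'a \<Rightarrow> complex \<Rightarrow> ('a \<Rightarrow> complex) \<Rightarrow> ('a \<Rightarrow> complex) \<Rightarrow>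
     complex \<Rightarrow> complex \<Rightarrow> complex \<Rightarrow> ('a \<Rightarrow> complex) \<Rightarrow> bool" where
  "family5 \<sigma> z\<^sub>0 l f g \<beta> b c chi \<longleftrightarrow>
     \<beta> \<noteq> 0 \<and> b \<noteq> 0 \<and>
     exponential chi \<and> chi \<noteq> chi \<circ> \<sigma> \<and>
     chi z\<^sub>0 = 1 / \<beta> \<and> (chi \<circ> \<sigma>) z\<^sub>0 = 1 / \<beta> \<and>
     f = (\<lambda>x. l * ((chi x + (chi \<circ> \<sigma>) x) / (2 * \<beta>))
            + (2 * \<beta> * b + l * c) * ((chi x - (chi \<circ> \<sigma>) x) / (2 * \<beta>))) \<and>
     g = (\<lambda>x. (chi x + (chi \<circ> \<sigma>) x) / (2 * \<beta>)
            + c * ((chi x - (chi \<circ> \<sigma>) x) / (2 * \<beta>)))"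

definition family6 ::
    "('a::semigroup_mult \<Rightarrow> 'a) \<Rightarrow> 'a \<Rightarrow> complex \<Rightarrow> ('a \<Rightarrow> complex) \<Rightarrow> ('a \<Rightarrow> complex) \<Rightarrow>
     complex \<Rightarrow> complex \<Rightarrow> complex \<Rightarrow> complex \<Rightarrow> ('a \<Rightarrow> complex) \<Rightarrow> bool" where
  "family6 \<sigma> z\<^sub>0 l f g \<alpha> \<delta> b c chi \<longleftrightarrow>
     \<alpha> \<noteq> 0 \<and> \<delta> \<noteq> 0 \<and> b \<noteq> 0 \<and>
     \<alpha> \<noteq> 2 * b * \<delta> + \<alpha> * c \<and> \<alpha> \<noteq> - (2 * b * \<delta> + \<alpha> * c) \<and>
     exponential chi \<and> chi \<noteq> chi \<circ> \<sigma> \<and>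
     chi z\<^sub>0 = 2 * b / (\<alpha> * (1 + c) + 2 * b * \<delta>) \<and>
     (chi \<circ> \<sigma>) z\<^sub>0 = 2 * b / (\<alpha> * (c - 1) + 2 * b * \<delta>) \<and>
     f = (\<lambda>x. (\<alpha> + l) * ((chi x + (chi \<circ> \<sigma>) x) / (2 * \<delta>))
            + (c * (\<alpha> + l) + 2 * b * \<delta>) * ((chi x - (chi \<circ> \<sigma>) x) / (2 * \<delta>))) \<and>
     g = (\<lambda>x. (chi x + (chi \<circ> \<sigma>) x) / (2 * \<delta>)
            + c * ((chi x - (chi \<circ> \<sigma>) x) / (2 * \<delta>)))"

definition family7 ::
    "('a::semigroup_mult \<Rightarrow> 'a) \<Rightarrow> 'a \<Rightarrow> complex \<Rightarrow> ('a \<Rightarrow> complex) \<Rightarrow> ('a \<Rightarrow> complex) \<Rightarrow>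
     complex \<Rightarrow> complex \<Rightarrow> ('a \<Rightarrow> complex) \<Rightarrow> ('a \<Rightarrow> complex) \<Rightarrow> ('a \<Rightarrow> complex) \<Rightarrow> bool" where
  "family7 \<sigma> z\<^sub>0 l f g \<gamma> c chi A \<rho> \<longleftrightarrow>
     \<gamma> \<noteq> 0 \<and> c \<noteq> 0 \<and>
     Psi_admissible chi A \<rho> \<and> (\<exists>x \<in> - null_space chi. A x \<noteq> 0) \<and>
     chi \<circ> \<sigma> = chi \<and>
     (\<forall>x \<in> - null_space chi. A (\<sigma> x) = - A x) \<and> (\<forall>x \<in> P_set chi. \<rho> (\<sigma> x) = - \<rho> x) \<and>
     chi z\<^sub>0 = -1 / c \<and> A z\<^sub>0 = -1 / c \<and>
     f = (\<lambda>x. \<gamma> * chi x + (\<gamma> * c + l) * Psi chi A \<rho> x) \<and>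
     g = Psi chi A \<rho>"

text \<open>
  In the last family the source asks for \<open>A \<noteq> 0\<close>.  Taken literally this loses the solutions with
  \<open>A = 0\<close>, \<open>\<alpha> = 0\<close> and \<open>\<rho> \<noteq> 0\<close>, for which \<open>\<Psi>\<close> is still non-zero.  Example: the commutative monoid
  \<open>{1, p, q, 0}\<close> with \<open>p\<close>, \<open>q\<close> having all products \<open>0\<close>, \<open>z\<^sub>0 = 1\<close>, \<open>\<sigma>\<close> swapping \<open>p\<close> and \<open>q\<close>,
  \<open>g\<close> the indicator of \<open>1\<close>, and \<open>f - \<lambda> g\<close> equal to \<open>1\<close> at \<open>p\<close>, \<open>-1\<close> at \<open>q\<close> and \<open>0\<close> elsewhere.  The
  condition is therefore read as: \<open>A\<close> and \<open>\<rho>\<close> are not both zero.  (In the previous family \<open>A \<noteq> 0\<close> is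
  automatic from the value at \<open>z\<^sub>0\<close>.)
\<close>

definition family8 ::
    "('a::semigroup_mult \<Rightarrow> 'a) \<Rightarrow> 'a \<Rightarrow> complex \<Rightarrow> ('a \<Rightarrow> complex) \<Rightarrow> ('a \<Rightarrow> complex) \<Rightarrow>
     complex \<Rightarrow> complex \<Rightarrow> complex \<Rightarrow> ('a \<Rightarrow> complex) \<Rightarrow> ('a \<Rightarrow> complex) \<Rightarrow> ('a \<Rightarrow> complex) \<Rightarrow> bool" where
  "family8 \<sigma> z\<^sub>0 l f g \<alpha> c \<delta> chi A \<rho> \<longleftrightarrow>
     \<delta> \<noteq> 0 \<and> \<alpha> * c + \<delta> \<noteq> 0 \<and>
     Psi_admissible chi A \<rho> \<and>
     ((\<exists>x \<in> - null_space chi. A x \<noteq> 0) \<or> (\<exists>x \<in> P_set chi. \<rho> x \<noteq> 0)) \<and>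
     chi \<circ> \<sigma> = chi \<and>
     (\<forall>x \<in> - null_space chi. A (\<sigma> x) = - A x) \<and> (\<forall>x \<in> P_set chi. \<rho> (\<sigma> x) = - \<rho> x) \<and>
     chi z\<^sub>0 = 1 / (\<alpha> * c + \<delta>) \<and> A z\<^sub>0 = - (\<alpha> / (\<alpha> * c + \<delta>)) \<and>
     f = (\<lambda>x. (\<alpha> + l) / \<delta> * chi x + (c * (l + \<alpha>) + \<delta>) / \<delta> * Psi chi A \<rho> x) \<and>
     g = (\<lambda>x. 1 / \<delta> * (chi x + c * Psi chi A \<rho> x))"

definition topological_semigroup :: "'a::semigroup_mult topology \<Rightarrow> bool" where
  "topological_semigroup T \<longleftrightarrow>
     topspace T = UNIV \<and> continuous_map (prod_topology T T) T (\<lambda>(x, y). x * y)"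

abbreviation cont_on :: "'a topology \<Rightarrow> 'a set \<Rightarrow> ('a \<Rightarrow> complex) \<Rightarrow> bool" where
  "cont_on T X h \<equiv> continuous_map (subtopology T X) euclidean h"

end

theory Submission
  imports Defs
begin

text \<open>
  Put \<open>h = f - \<lambda> g\<close>; then \<open>\<lambda>\<close> disappears and the equation becomes
  \<open>h (x \<sigma>(y) z\<^sub>0) = h x g y - h y g x\<close>.  If \<open>h\<close> and \<open>g\<close> are linearly dependent, the right-hand side
  vanishes, which gives the first three families.  Otherwise associativity makes the span of \<open>h\<close>
  and \<open>g\<close> invariant under left and right translations.  The left translation by \<open>\<sigma> y\<close> is the
  adjugate of the matrix \<open>M y\<close> of the right translation by \<open>y\<close>.  Since left and right translations
  commute, so do all the matrices \<open>M y\<close>, hence \<open>M y = t y I + n y N\<close> with one fixed traceless \<open>N\<close>.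
  The value of \<open>h\<close> and \<open>g\<close> at \<open>y\<close> is read off from the translation by \<open>\<sigma> y\<close> followed by \<open>z\<^sub>0\<close>, so
  that left and right translations coincide; therefore \<open>t\<close> is even and \<open>n\<close> odd under \<open>\<sigma>\<close>, and \<open>h\<close>, \<open>g\<close>
  lie in the span of \<open>t\<close> and \<open>n\<close>.  With \<open>N\<^sup>2 = \<nu> I\<close>, the functions \<open>t \<plusminus> \<surd>\<nu> n\<close> are exponentials
  interchanged by \<open>\<sigma>\<close> when \<open>\<nu> \<noteq> 0\<close>; when \<open>\<nu> = 0\<close>, \<open>t\<close> is an exponential and \<open>n\<close> satisfies the sine
  addition law over it.  Comparing coefficients in the equation yields the values at \<open>z\<^sub>0\<close>.
\<close>

section \<open>The reduced equation and linear algebra of two functions\<close>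

definition sine_subtraction ::
    "('a::semigroup_mult \<Rightarrow> 'a) \<Rightarrow> 'a \<Rightarrow> ('a \<Rightarrow> complex) \<Rightarrow> ('a \<Rightarrow> complex) \<Rightarrow> bool" where
  "sine_subtraction \<sigma> z h g \<longleftrightarrow> (\<forall>x y. h (x * \<sigma> y * z) = h x * g y - h y * g x)"

definition lin_indep :: "('a \<Rightarrow> complex) \<Rightarrow> ('a \<Rightarrow> complex) \<Rightarrow> bool" where
  "lin_indep h g \<longleftrightarrow> (\<forall>p q. (\<forall>x. p * h x + q * g x = 0) \<longrightarrow> p = 0 \<and> q = 0)"

lemma lin_indepD:
  assumes "lin_indep h g" and "\<And>x. p * h x + q * g x = 0"
  shows "p = 0" and "q = 0"
  using assms unfolding lin_indep_def by blast+

lemma lin_indep_coeffs_eq: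
  assumes "lin_indep h g" and "\<And>x. p * h x + q * g x = p' * h x + q' * g x"
  shows "p = p'" and "q = q'"
proof -
  have "(p - p') * h x + (q - q') * g x = 0" for x
    using assms(2)[of x] by (simp add: algebra_simps)
  from lin_indepD[OF assms(1) this] show "p = p'" "q = q'" by simp_all
qed

text \<open>If all these minors vanished, fixing \<open>w\<close> would give a linear relation with
  coefficients \<open>g w\<close> and \<open>- h w\<close>. Independence then makes
  \<open>h w\<close> zero for every \<open>w\<close>, so \<open>h\<close> itself is zero, a
  contradiction.\<close>

lemma lin_indep_det_nonzero:
  assumes "lin_indep h g"
  obtains w v where "h w * g v - h v * g w \<noteq> 0"
proof -
  have False if all: "\<And>w v. h w * g v - h v * g w = 0"
  proof -
    have "h w = 0" for w
    proof -
      have "g w * h x + (- h w) * g x = 0" for x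
        using all[of x w] by (simp add: mult.commute)
      from lin_indepD(2)[OF assms this] show ?thesis by simp
    qed
    then have "1 * h x + 0 * g x = 0" for x by simp
    from lin_indepD(1)[OF assms this] show False by simp
  qed
  then show thesis using that by blast
qed

text \<open>Determinants multiply: a minor of \<open>h\<close>, \<open>g\<close> is the coefficient
  determinant times the corresponding minor of \<open>u\<close>, \<open>v\<close>, and some minor of
  \<open>h\<close>, \<open>g\<close> is non-zero. The same factorisation gives the next
  lemma.\<close>

lemma lin_indep_combination_det:
  assumes "lin_indep h g"
    and "\<And>x. h x = p * u x + q * v x" and "\<And>x. g x = r * u x + s * v x"
  shows "p * s - q * r \<noteq> 0"
proof
  assume D: "p * s - q * r = 0"
  obtain w w' where w: "h w * g w' - h w' * g w \<noteq> 0"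
    using lin_indep_det_nonzero[OF assms(1)] .
  have "h w * g w' - h w' * g w = (p * s - q * r) * (u w * v w' - v w * u w')"
    unfolding assms(2,3) by (simp add: algebra_simps)
  then show False using D w by simp
qed

lemma lin_indep_of_combination:
  assumes "lin_indep h g"
    and h: "\<And>x. h x = p * u x + q * v x" and g: "\<And>x. g x = r * u x + s * v x"
  shows "lin_indep u v"
  unfolding lin_indep_def
proof (intro allI impI)
  fix a b assume ab: "\<forall>x. a * u x + b * v x = 0"
  obtain w w' where w: "h w * g w' - h w' * g w \<noteq> 0"
    using lin_indep_det_nonzero[OF assms(1)] .
  have "h w * g w' - h w' * g w = (p * s - q * r) * (u w * v w' - v w * u w')"
    unfolding h g by (simp add: algebra_simps)
  then have d: "u w * v w' - v w * u w' \<noteq> 0" using w by auto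
  have 1: "a * u w + b * v w = 0" "a * u w' + b * v w' = 0" using ab by auto
  have "a * (u w * v w' - v w * u w') = 0" using 1 by algebra
  moreover have "b * (u w * v w' - v w * u w') = 0" using 1 by algebra
  ultimately show "a = 0 \<and> b = 0" using d by auto
qed

lemma divide_times_eqI:
  fixes u v w d :: "'a::field"
  assumes "d \<noteq> 0" "u * d = v * w"
  shows "u = v / d * w"
  using assms by (simp add: nonzero_eq_divide_eq)

text \<open>The hypotheses say that the vectors \<open>(b x, c x, e x)\<close> are pairwise
  parallel, so all are multiples of any non-zero one among them. The last clause fixes
  \<open>n\<close> when the common direction is zero; it allows identities for \<open>n\<close> to
  be proved after multiplying by \<open>B\<close>, \<open>C\<close> and \<open>E\<close>.\<close>

lemma proportional_triple:
  fixes b c e :: "'a \<Rightarrow> complex"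
  assumes "\<And>x y. b x * c y = b y * c x" "\<And>x y. b x * e y = b y * e x"
    "\<And>x y. c x * e y = c y * e x"
  obtains n B C E where "\<forall>x. b x = n x * B \<and> c x = n x * C \<and> e x = n x * E"
    "B = 0 \<and> C = 0 \<and> E = 0 \<longrightarrow> n = (\<lambda>x. 0)"
proof -
  consider w where "b w \<noteq> 0" | w where "c w \<noteq> 0" | w where "e w \<noteq> 0"
    | "\<forall>x. b x = 0 \<and> c x = 0 \<and> e x = 0" by blast
  then show thesis
  proof cases
    case (1 w)
    have bw: "b x = b x / b w * b w" for x
      by (simp_all add: 1)
    have cw: "c x = b x / b w * c w" for x
      by (rule divide_times_eqI[OF 1]) (use assms(1)[of w x] in algebra)
    have ew: "e x = b x / b w * e w" for x
      by (rule divide_times_eqI[OF 1]) (use assms(2)[of w x] in algebra)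
    show ?thesis
      by (rule that[of "\<lambda>x. b x / b w" "b w" "c w" "e w"], use bw cw ew in blast) (use 1 in simp)
  next
    case (2 w)
    have bw: "b x = c x / c w * b w" for x
      by (rule divide_times_eqI[OF 2]) (use assms(1)[of w x] in algebra)
    have cw: "c x = c x / c w * c w" for x
      by (simp_all add: 2)
    have ew: "e x = c x / c w * e w" for x
      by (rule divide_times_eqI[OF 2]) (use assms(3)[of w x] in algebra)
    show ?thesis
      by (rule that[of "\<lambda>x. c x / c w" "b w" "c w" "e w"], use bw cw ew in blast) (use 2 in simp)
  next
    case (3 w)
    have bw: "b x = e x / e w * b w" for x
      by (rule divide_times_eqI[OF 3]) (use assms(2)[of w x] in algebra)
    have cw: "c x = e x / e w * c w" for x
      by (rule divide_times_eqI[OF 3]) (use assms(3)[of w x] in algebra)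
    have ew: "e x = e x / e w * e w" for x
      by (simp_all add: 3)
    show ?thesis
      by (rule that[of "\<lambda>x. e x / e w" "b w" "c w" "e w"], use bw cw ew in blast) (use 3 in simp)
  next
    case 4
    then show ?thesis by (intro that[of "\<lambda>x. 0" 0 0 0]) auto
  qed
qed

section \<open>Structure of the linearly independent solutions\<close>

lemma sine_subtraction_structure:
  assumes \<sigma>: "involutive_automorphism \<sigma>"
    and eq: "sine_subtraction \<sigma> z h g" and ind: "lin_indep h g"
  obtains t n and \<nu> p q r s :: complex
  where "\<And>x. t (\<sigma> x) = t x" "\<And>x. n (\<sigma> x) = - n x"
    "\<And>x y. t (x * y) = t x * t y + \<nu> * n x * n y"
    "\<And>x y. n (x * y) = t x * n y + n x * t y"
    "\<And>x. h x = p * t x + q * n x" "\<And>x. g x = r * t x + s * n x"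
proof -
  have \<sigma>mult: "\<sigma> (x * y) = \<sigma> x * \<sigma> y" and \<sigma>\<sigma>[simp]: "\<sigma> (\<sigma> x) = x" for x y
    using \<sigma> by (auto simp: involutive_automorphism_def)
  have E: "h (x * \<sigma> y * z) = h x * g y - h y * g x" for x y
    using eq by (simp add: sine_subtraction_def)
  note coeffs = lin_indep_coeffs_eq[OF ind]
  \<comment> \<open>Both sides equal \<open>h (x * y * \<sigma> w * z)\<close>: the product
    \<open>y * \<sigma> w\<close> is also \<open>\<sigma> (\<sigma> y * w)\<close>, so the equation
    applies to the pairs \<open>x * y\<close>, \<open>w\<close> and \<open>x\<close>,
    \<open>\<sigma> y * w\<close>.\<close>
  have shift: "h (x * y) * g w - g (x * y) * h w = h x * g (\<sigma> y * w) - g x * h (\<sigma> y * w)" for x y w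
    using E[of "x * y" w] E[of x "\<sigma> y * w"] by (simp add: \<sigma>mult mult.assoc mult.commute)
  obtain w v where wv: "h w * g v - h v * g w \<noteq> 0"
    using lin_indep_det_nonzero[OF ind] .
  define \<Delta> where "\<Delta> = h w * g v - h v * g w"
  \<comment> \<open>the matrix with rows \<open>(a y, b y)\<close> and \<open>(c y, d y)\<close> is \<open>M y\<close>, obtained by Cramer's rule from \<open>shift\<close>\<close>
  define a where "a y = (g (\<sigma> y * v) * h w - g (\<sigma> y * w) * h v) / \<Delta>" for y
  define b where "b y = (h (\<sigma> y * w) * h v - h (\<sigma> y * v) * h w) / \<Delta>" for y
  define c where "c y = (g (\<sigma> y * v) * g w - g (\<sigma> y * w) * g v) / \<Delta>" for y
  define d where "d y = (h (\<sigma> y * w) * g v - h (\<sigma> y * v) * g w) / \<Delta>" for y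
  have \<Delta>: "\<Delta> \<noteq> 0" using wv \<Delta>_def by simp
  have hR: "h (x * y) = a y * h x + b y * g x" for x y
  proof -
    have "h (x * y) * \<Delta> = (g (\<sigma> y * v) * h w - g (\<sigma> y * w) * h v) * h x
        + (h (\<sigma> y * w) * h v - h (\<sigma> y * v) * h w) * g x"
      using shift[of x y w] shift[of x y v] unfolding \<Delta>_def by algebra
    then show ?thesis
      unfolding a_def b_def times_divide_eq_left add_divide_distrib[symmetric]
      using \<Delta> by (simp only: nonzero_eq_divide_eq not_False_eq_True)
  qed
  have gR: "g (x * y) = c y * h x + d y * g x" for x y
  proof -
    have "g (x * y) * \<Delta> = (g (\<sigma> y * v) * g w - g (\<sigma> y * w) * g v) * h x
        + (h (\<sigma> y * w) * g v - h (\<sigma> y * v) * g w) * g x"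
      using shift[of x y w] shift[of x y v] unfolding \<Delta>_def by algebra
    then show ?thesis
      unfolding c_def d_def times_divide_eq_left add_divide_distrib[symmetric]
      using \<Delta> by (simp only: nonzero_eq_divide_eq not_False_eq_True)
  qed
  \<comment> \<open>Inserting the right translations into \<open>shift\<close> and comparing the
    coefficients of \<open>h x\<close> and \<open>g x\<close> shows that the left translation by
    \<open>\<sigma> y\<close> has the adjugate matrix of \<open>M y\<close>.\<close>
  have left: "g (\<sigma> y * w) = a y * g w - c y * h w" "h (\<sigma> y * w) = d y * h w - b y * g w" for y w
  proof -
    have "(a y * g w - c y * h w) * h x + (b y * g w - d y * h w) * g x
        = g (\<sigma> y * w) * h x + (- h (\<sigma> y * w)) * g x" for x
      using shift[of x y w] unfolding hR gR by (simp add: algebra_simps)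
    from coeffs[OF this] show "g (\<sigma> y * w) = a y * g w - c y * h w"
      "h (\<sigma> y * w) = d y * h w - b y * g w" by (simp_all add: algebra_simps)
  qed
  \<comment> \<open>The product \<open>\<sigma> x * y * w\<close> is bracketed in two ways, so the
    adjugate of \<open>M x\<close> commutes with \<open>M w\<close>. Together with
    \<open>comm2\<close> this says that the traceless parts of \<open>M x\<close> and
    \<open>M w\<close> are parallel.\<close>
  have comm1: "b w * c x = b x * c w" "b w * (a x - d x) = b x * (a w - d w)" for w x
  proof -
    have "(a w * d x - b w * c x) * h y + (b w * a x - a w * b x) * g y
        = (d x * a w - b x * c w) * h y + (d x * b w - b x * d w) * g y" for y
      using hR[of "\<sigma> x * y" w] left(2)[of x "y * w"]
      unfolding mult.assoc[of "\<sigma> x"] hR[of y w] gR[of y w] left[of x y]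
      by (simp add: algebra_simps)
    from coeffs[OF this] show "b w * c x = b x * c w" "b w * (a x - d x) = b x * (a w - d w)"
      by (simp_all add: algebra_simps)
  qed
  have comm2: "c w * (a x - d x) = c x * (a w - d w)" for w x
  proof -
    have "(c w * d x - d w * c x) * h y + (d w * a x - c w * b x) * g y
        = (a x * c w - c x * a w) * h y + (a x * d w - c x * b w) * g y" for y
      using gR[of "\<sigma> x * y" w] left(1)[of x "y * w"]
      unfolding mult.assoc[of "\<sigma> x"] hR[of y w] gR[of y w] left[of x y]
      by (simp add: algebra_simps)
    from coeffs(1)[OF this] show ?thesis by (simp add: algebra_simps)
  qed
  \<comment> \<open>The left side of the equation is expanded by the right translations by
    \<open>z\<close> and then by \<open>\<sigma> y\<close>; the coefficients of \<open>h x\<close>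
    and \<open>g x\<close> are compared.\<close>
  have vals: "g y = a z * a (\<sigma> y) + b z * c (\<sigma> y)" "- h y = a z * b (\<sigma> y) + b z * d (\<sigma> y)" for y
  proof -
    have "g y * h x + (- h y) * g x = (a z * a (\<sigma> y) + b z * c (\<sigma> y)) * h x
         + (a z * b (\<sigma> y) + b z * d (\<sigma> y)) * g x" for x
      using E[of x y] unfolding hR gR by (simp add: algebra_simps)
    from coeffs[OF this] show "g y = a z * a (\<sigma> y) + b z * c (\<sigma> y)"
      "- h y = a z * b (\<sigma> y) + b z * d (\<sigma> y)" by blast+
  qed
  have left': "g (x * y) = a (\<sigma> x) * g y - c (\<sigma> x) * h y"
    "h (x * y) = d (\<sigma> x) * h y - b (\<sigma> x) * g y" for x y
    using left[of "\<sigma> x" y] by simp_all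
  \<comment> \<open>After substituting \<open>vals\<close> into the left translation formulas, the
    expressions are symmetric in \<open>x\<close> and \<open>y\<close> precisely by the commutation
    relations.\<close>
  have gc: "g (x * y) = g (y * x)" and hc: "h (x * y) = h (y * x)" for x y
  proof -
    note c1 = comm1[of "\<sigma> x" "\<sigma> y"] comm2[of "\<sigma> x" "\<sigma> y"]
    show "g (x * y) = g (y * x)"
      unfolding left' using vals[of x] vals[of y] c1 by algebra
    show "h (x * y) = h (y * x)"
      unfolding left' using vals[of x] vals[of y] c1 by algebra
  qed
  \<comment> \<open>By \<open>gc\<close> and \<open>hc\<close> right and left translation by
    \<open>y\<close> agree, so \<open>M y\<close> is the adjugate of
    \<open>M (\<sigma> y)\<close>.\<close>
  have adj: "a (\<sigma> y) = d y" "b (\<sigma> y) = - b y" "c (\<sigma> y) = - c y" "d (\<sigma> y) = a y" for y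
  proof -
    have "a y * h x + b y * g x = d (\<sigma> y) * h x + (- b (\<sigma> y)) * g x" for x
      using hc[of x y] unfolding hR[of x y] left'(2)[of y x] by simp
    from coeffs[OF this] show "b (\<sigma> y) = - b y" "d (\<sigma> y) = a y" by simp_all
    have "c y * h x + d y * g x = (- c (\<sigma> y)) * h x + a (\<sigma> y) * g x" for x
      using gc[of x y] unfolding gR[of x y] left'(1)[of y x] by simp
    from coeffs[OF this] show "c (\<sigma> y) = - c y" "a (\<sigma> y) = d y" by simp_all
  qed
  \<comment> \<open>Associativity, read as the matrix identity
    \<open>M (x * y) = M y M x\<close>.\<close>
  have prod: "a (x * y) = a x * a y + b y * c x" "b (x * y) = a y * b x + b y * d x"
     "c (x * y) = c y * a x + d y * c x" "d (x * y) = c y * b x + d y * d x" for x y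
  proof -
    have "a (x * y) * h u + b (x * y) * g u
      = (a x * a y + b y * c x) * h u + (a y * b x + b y * d x) * g u" for u
      using hR[of "u * x" y] unfolding mult.assoc hR[of u] gR[of u] by (simp add: algebra_simps)
    from coeffs[OF this]
    show "a (x * y) = a x * a y + b y * c x" "b (x * y) = a y * b x + b y * d x" .
    have "c (x * y) * h u + d (x * y) * g u
      = (c y * a x + d y * c x) * h u + (c y * b x + d y * d x) * g u" for u
      using gR[of "u * x" y] unfolding mult.assoc hR[of u] gR[of u] by (simp add: algebra_simps)
    from coeffs[OF this]
    show "c (x * y) = c y * a x + d y * c x" "d (x * y) = c y * b x + d y * d x" .
  qed
  have comm3: "b x * ((a y - d y) / 2) = b y * ((a x - d x) / 2)"
    "c x * ((a y - d y) / 2) = c y * ((a x - d x) / 2)" for x y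
    using comm1(2)[of x y] comm2[of x y] by simp_all
  obtain n B C E where N': "\<forall>x. b x = n x * B \<and> c x = n x * C \<and> (a x - d x) / 2 = n x * E"
    and N0: "B = 0 \<and> C = 0 \<and> E = 0 \<longrightarrow> n = (\<lambda>x. 0)"
    using proportional_triple[of b c "\<lambda>x. (a x - d x) / 2", OF comm1(1) comm3] .
  have N: "b x = n x * B" "c x = n x * C" "(a x - d x) / 2 = n x * E" for x
    using N' by blast+
  define t where "t x = (a x + d x) / 2" for x
  have ad: "a x = t x + n x * E" "d x = t x - n x * E" for x
    using N(3)[of x] by (simp_all add: t_def field_simps)
  show thesis
  \<comment> \<open>Here \<open>N\<close> has rows \<open>(B C-free entry E, B)\<close> in the form
    \<open>(E, B)\<close> and \<open>(C, - E)\<close>, so its square is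
    \<open>E\<^sup>2 + B * C\<close> times the identity. The other four constants are read off from
    \<open>vals\<close> after rewriting with \<open>adj\<close>.\<close>
  proof (rule that[of t n "E\<^sup>2 + B * C" "- b z" "- b z * E + a z * B" "a z" "- b z * C - a z * E"])
    show "t (\<sigma> x) = t x" for x by (simp add: t_def adj)
    \<comment> \<open>An identity may be tested after multiplication by each of \<open>B\<close>,
      \<open>C\<close>, \<open>E\<close>; should all three be zero, \<open>n\<close> is the zero
      function by the choice in \<open>N0\<close>.\<close>
    have cancel: "u = v" if "u * B = v * B" "u * C = v * C" "u * E = v * E"
      "n = (\<lambda>x. 0) \<Longrightarrow> u = v" for u v
      using that N0 by (metis mult_right_cancel)
    have e: "n (\<sigma> x) * B = - n x * B" "n (\<sigma> x) * C = - n x * C" "n (\<sigma> x) * E = - n x * E" for x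
      unfolding mult_minus_left N[symmetric] adj by (simp_all add: field_simps)
    show "n (\<sigma> x) = - n x" for x
      by (rule cancel[OF e]) simp
    show "t (x * y) = t x * t y + (E\<^sup>2 + B * C) * n x * n y" for x y
      unfolding t_def prod unfolding ad N(1,2) by (simp add: field_simps power2_eq_square)
    have B: "n (x * y) * B = (t x * n y + n x * t y) * B" for x y
      using prod(2)[of x y] unfolding ad N(1,2) by (simp add: algebra_simps)
    have C: "n (x * y) * C = (t x * n y + n x * t y) * C" for x y
      using prod(3)[of x y] unfolding ad N(1,2) by (simp add: algebra_simps)
    have E: "n (x * y) * E = (t x * n y + n x * t y) * E" for x y
      unfolding N(3)[symmetric] unfolding prod unfolding ad N(1,2) by (simp add: field_simps)
    show "n (x * y) = t x * n y + n x * t y" for x y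
      by (rule cancel[OF B C E]) simp
    show "h x = - b z * t x + (- b z * E + a z * B) * n x" for x
      using vals(2)[of x] unfolding adj ad[of x] N(1,2)[of x]  by (simp add: algebra_simps)
    show "g x = a z * t x + (- b z * C - a z * E) * n x" for x
      using vals(1)[of x] unfolding adj ad[of x] N(1,2)[of x] by (simp add: algebra_simps)
  qed
qed

section \<open>The sine addition law and the functions \<open>Psi\<close>\<close>

text \<open>The addition law makes \<open>n\<close> vanish on products of two null elements.
  Multiplying a null \<open>x\<close> by elements outside the null space changes \<open>n x\<close>
  only by a non-zero factor, so \<open>n\<close> vanishes at every null point outside
  \<open>P_set chi\<close>.\<close>

lemma sine_addition_Psi:
  assumes chi: "exponential chi"
    and n: "\<And>x y. n (x * y) = n x * chi y + chi x * n y"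
  shows "Psi chi (\<lambda>x. n x / chi x) n = n"
    and "Psi_admissible chi (\<lambda>x. n x / chi x) n"
proof -
  have mult: "chi (x * y) = chi x * chi y" for x y
    using chi by (simp add: exponential_def multiplicative_def)
  have sq: "n x = 0" if "x \<in> set_sq (null_space chi)" for x
    using that by (auto simp: set_sq_def null_space_def n)
  have zero: "n x = 0" if x: "chi x = 0" "x \<notin> P_set chi" for x
  proof -
    consider "x \<in> set_sq (null_space chi)"
      | u where "chi u \<noteq> 0" "u * x \<in> set_sq (null_space chi)"
      | u where "chi u \<noteq> 0" "x * u \<in> set_sq (null_space chi)"
      | u v where "chi u \<noteq> 0" "chi v \<noteq> 0" "u * x * v \<in> set_sq (null_space chi)"
      using x by (auto simp: P_set_def null_space_def mult)
    then show ?thesis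
    proof cases
      case 1 then show ?thesis by (rule sq)
    next
      case 2 then show ?thesis using sq[OF 2(2)] x by (simp add: n)
    next
      case 3 then show ?thesis using sq[OF 3(2)] x by (simp add: n)
    next
      case 4 then show ?thesis using sq[OF 4(3)] x by (simp add: n mult)
    qed
  qed
  show Psi: "Psi chi (\<lambda>x. n x / chi x) n = n"
    by (auto simp: Psi_def null_space_def zero)
  have "additive_on (- null_space chi) (\<lambda>x. n x / chi x)"
    by (auto simp: additive_on_def null_space_def n mult field_simps)
  then show "Psi_admissible chi (\<lambda>x. n x / chi x) n"
    unfolding Psi_admissible_def Psi using chi
    by (auto simp: P_set_def null_space_def n mult zero)
qed

text \<open>Converse of the preceding lemma. If both factors are null, their product is a product of
  null elements, hence null and outside \<open>P_set chi\<close>, and both sides are zero; the other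
  cases are the admissibility conditions.\<close>

lemma Psi_sine_addition:
  assumes "Psi_admissible chi A \<rho>"
  shows "Psi chi A \<rho> (x * y) = Psi chi A \<rho> x * chi y + chi x * Psi chi A \<rho> y"
proof -
  have mult: "chi (x * y) = chi x * chi y" for x y
    using assms by (simp add: Psi_admissible_def exponential_def multiplicative_def)
  \<comment> \<open>\<open>P_set chi\<close> is stable under translation by non-null
    \<open>u\<close>, because \<open>u\<close> can be absorbed into the multipliers quantified over
    in its definition.\<close>
  have P: "u * p \<in> P_set chi" "p * u \<in> P_set chi" if p: "p \<in> P_set chi" "chi u \<noteq> 0" for u p
  proof -
    have nz: "v * u \<in> - null_space chi" "u * v \<in> - null_space chi" "u \<in> - null_space chi"
      if "v \<in> - null_space chi" for v
      using that p(2) by (auto simp: null_space_def mult)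
    have *: "v * p \<in> null_space chi - set_sq (null_space chi)"
        "p * w \<in> null_space chi - set_sq (null_space chi)"
        "v * p * w \<in> null_space chi - set_sq (null_space chi)"
      if "v \<in> - null_space chi" "w \<in> - null_space chi" for v w
      using p(1) that unfolding P_set_def by blast+
    have u: "u \<in> - null_space chi" using p(2) by (simp add: null_space_def)
    show "u * p \<in> P_set chi"
      unfolding P_set_def using u *(1)[OF u u] *(1)[OF nz(1)] *(3)[OF u] *(3)[OF nz(1)]
      by (auto simp: mult.assoc)
    show "p * u \<in> P_set chi"
      unfolding P_set_def using u *(2)[OF u u] *(2)[OF _ nz(2)] *(3)[OF _ u] *(3)[OF _ nz(2)]
      by (auto simp: mult.assoc)
  qed
  have PI: "chi p = 0" if "p \<in> P_set chi" for p
    using that by (auto simp: P_set_def null_space_def)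
  consider "chi x \<noteq> 0" "chi y \<noteq> 0" | "chi x \<noteq> 0" "y \<in> P_set chi" | "chi y \<noteq> 0" "x \<in> P_set chi"
    | "chi x \<noteq> 0" "chi y = 0" "y \<notin> P_set chi" | "chi y \<noteq> 0" "chi x = 0" "x \<notin> P_set chi"
    | "chi x = 0" "chi y = 0"
    by blast
  then show ?thesis
  proof cases
    case 1
    then show ?thesis using assms
      by (simp add: Psi_admissible_def additive_on_def Psi_def null_space_def mult algebra_simps)
  next
    case 2
    then have "\<rho> (x * y) = \<rho> y * chi x"
      using assms unfolding Psi_admissible_def null_space_def by blast
    with 2 show ?thesis by (simp add: Psi_def null_space_def P PI mult)
  next
    case 3
    then have "\<rho> (x * y) = \<rho> x * chi y"
      using assms unfolding Psi_admissible_def null_space_def by blast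
    with 3 show ?thesis by (simp add: Psi_def null_space_def P PI mult)
  next
    case 4
    then have "Psi chi A \<rho> (x * y) = 0"
      using assms unfolding Psi_admissible_def null_space_def by blast
    with 4 show ?thesis by (simp add: Psi_def null_space_def)
  next
    case 5
    then have "Psi chi A \<rho> (x * y) = 0"
      using assms unfolding Psi_admissible_def null_space_def by blast
    with 5 show ?thesis by (simp add: Psi_def null_space_def)
  next
    case 6
    then have "x * y \<in> set_sq (null_space chi)"
      by (auto simp: set_sq_def null_space_def)
    then have "x * y \<notin> P_set chi" by (auto simp: P_set_def)
    with 6 show ?thesis by (simp add: Psi_def null_space_def mult)
  qed
qed

text \<open>Since \<sigma> is an automorphism preserving \<open>chi\<close>, it preserves the null
  space, its products and hence \<open>P_set chi\<close>; applying \<sigma> twice turns each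
  inclusion into an equivalence. So \<open>x\<close> and \<open>\<sigma> x\<close> fall into the
  same branch of \<open>Psi\<close>.\<close>

lemma Psi_odd:
  assumes \<sigma>: "involutive_automorphism \<sigma>" and chi: "chi \<circ> \<sigma> = chi"
    and A: "\<forall>x \<in> - null_space chi. A (\<sigma> x) = - A x"
    and \<rho>: "\<forall>x \<in> P_set chi. \<rho> (\<sigma> x) = - \<rho> x"
  shows "Psi chi A \<rho> (\<sigma> x) = - Psi chi A \<rho> x"
proof -
  have \<sigma>mult: "\<sigma> (x * y) = \<sigma> x * \<sigma> y" and \<sigma>\<sigma>: "\<sigma> (\<sigma> x) = x" for x y
    using \<sigma> by (auto simp: involutive_automorphism_def)
  have I: "\<sigma> x \<in> null_space chi \<longleftrightarrow> x \<in> null_space chi" for x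
    using fun_cong[OF chi, of x] by (simp add: null_space_def)
  have sq: "\<sigma> x \<in> set_sq (null_space chi)" if "x \<in> set_sq (null_space chi)" for x
    using that I \<sigma>mult unfolding set_sq_def by blast
  have D: "\<sigma> x \<in> null_space chi - set_sq (null_space chi)
      \<longleftrightarrow> x \<in> null_space chi - set_sq (null_space chi)" for x
    using I sq[of x] sq[of "\<sigma> x"] by (auto simp: \<sigma>\<sigma>)
  have P: "\<sigma> x \<in> P_set chi" if x: "x \<in> P_set chi" for x
    unfolding P_set_def
  proof (intro CollectI conjI ballI)
    show "\<sigma> x \<in> null_space chi - set_sq (null_space chi)"
      using x D by (simp add: P_set_def)
    fix u v assume uv: "u \<in> - null_space chi" "v \<in> - null_space chi"
    then have "\<sigma> u \<in> - null_space chi" "\<sigma> v \<in> - null_space chi" using I by auto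
    then have *: "\<sigma> u * x \<in> null_space chi - set_sq (null_space chi)"
        "x * \<sigma> v \<in> null_space chi - set_sq (null_space chi)"
        "\<sigma> u * x * \<sigma> v \<in> null_space chi - set_sq (null_space chi)"
      using x unfolding P_set_def by blast+
    show "u * \<sigma> x \<in> null_space chi - set_sq (null_space chi)"
      "\<sigma> x * v \<in> null_space chi - set_sq (null_space chi)"
      "u * \<sigma> x * v \<in> null_space chi - set_sq (null_space chi)"
      using D[of "\<sigma> u * x"] D[of "x * \<sigma> v"] D[of "\<sigma> u * x * \<sigma> v"] * by (simp_all only: \<sigma>mult \<sigma>\<sigma>)
  qed
  have "\<sigma> x \<in> P_set chi \<longleftrightarrow> x \<in> P_set chi"
    using P[of x] P[of "\<sigma> x"] by (auto simp: \<sigma>\<sigma>)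
  then show ?thesis
    using A \<rho> I[of x] fun_cong[OF chi, of x] by (simp add: Psi_def)
qed

section \<open>Solutions built from two distinct exponentials\<close>

text \<open>
  The common form of families 4, 5 and 6 (with \<open>h = f - \<lambda> g\<close>): family 4 is the case \<open>r + s = 0\<close>, family 5
  the case \<open>r + s \<noteq> 0 = p + q\<close>, and family 6 the remaining one.
\<close>

definition exponential_solution ::
    "('a::semigroup_mult \<Rightarrow> 'a) \<Rightarrow> 'a \<Rightarrow> ('a \<Rightarrow> complex) \<Rightarrow> ('a \<Rightarrow> complex) \<Rightarrow>
     complex \<Rightarrow> complex \<Rightarrow> complex \<Rightarrow> complex \<Rightarrow> ('a \<Rightarrow> complex) \<Rightarrow> bool" where
  "exponential_solution \<sigma> z h g p q r s chi \<longleftrightarrow>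
     exponential chi \<and> chi \<noteq> chi \<circ> \<sigma> \<and> p * s - q * r \<noteq> 0 \<and>
     p * chi z = p * s - q * r \<and> q * chi (\<sigma> z) = - (p * s - q * r) \<and>
     (\<forall>x. h x = p * chi x + q * chi (\<sigma> x)) \<and> (\<forall>x. g x = r * chi x + s * chi (\<sigma> x))"

text \<open>The right-hand side collapses to the determinant times
  \<open>chi x * chi (\<sigma> y) - chi (\<sigma> x) * chi y\<close>; the two conditions at
  \<open>z\<close> match exactly these two terms.\<close>

lemma exponential_solution_solves:
  assumes \<sigma>: "involutive_automorphism \<sigma>" and "exponential_solution \<sigma> z h g p q r s chi"
  shows "sine_subtraction \<sigma> z h g"
  unfolding sine_subtraction_def
proof (intro allI)
  fix x y
  have \<sigma>mult: "\<sigma> (x * y) = \<sigma> x * \<sigma> y" and \<sigma>\<sigma>: "\<sigma> (\<sigma> x) = x" for x y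
    using \<sigma> by (auto simp: involutive_automorphism_def)
  have mult: "chi (x * y) = chi x * chi y" for x y
    using assms by (simp add: exponential_solution_def exponential_def multiplicative_def)
  have hg: "h x = p * chi x + q * chi (\<sigma> x)" "g x = r * chi x + s * chi (\<sigma> x)" for x
    using assms(2) by (auto simp: exponential_solution_def)
  have z: "p * chi z = p * s - q * r" "q * chi (\<sigma> z) = - (p * s - q * r)"
    using assms(2) by (auto simp: exponential_solution_def)
  show "h (x * \<sigma> y * z) = h x * g y - h y * g x"
    unfolding hg \<sigma>mult mult \<sigma>\<sigma> using z by algebra
qed

lemma family4_exponential_solution:
  assumes "family4 \<sigma> z l f g \<gamma> b c chi"
  shows "exponential_solution \<sigma> z (\<lambda>x. f x - l * g x) g
    ((1 + c) / (2 * \<gamma>)) ((1 - c) / (2 * \<gamma>)) b (- b) chi"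
proof -
  note F = assms[unfolded family4_def]
  have c: "\<gamma> \<noteq> 0" "b \<noteq> 0" "1 + c \<noteq> 0" "1 - c \<noteq> 0"
    using F by (auto simp: add_eq_0_iff)
  have D: "(1 + c) / (2 * \<gamma>) * - b - (1 - c) / (2 * \<gamma>) * b = - b / \<gamma>"
    using c(1) by (simp add: field_simps)
  have z: "chi z = -2 * b / (1 + c)" "chi (\<sigma> z) = 2 * b / (1 - c)" using F by auto
  have "(1 + c) / (2 * \<gamma>) * chi z = - b / \<gamma>" "(1 - c) / (2 * \<gamma>) * chi (\<sigma> z) = b / \<gamma>"
    unfolding z using c by simp_all
  with D F c show ?thesis
    unfolding exponential_solution_def by (auto simp: field_simps)
qed

lemma family5_exponential_solution:
  assumes "family5 \<sigma> z l f g \<beta> b c chi"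
  shows "exponential_solution \<sigma> z (\<lambda>x. f x - l * g x) g
    b (- b) ((1 + c) / (2 * \<beta>)) ((1 - c) / (2 * \<beta>)) chi"
proof -
  note F = assms[unfolded family5_def]
  have c: "\<beta> \<noteq> 0" "b \<noteq> 0" using F by auto
  have D: "b * ((1 - c) / (2 * \<beta>)) - (- b) * ((1 + c) / (2 * \<beta>)) = b / \<beta>"
    using c(1) by (simp add: field_simps)
  have z: "chi z = 1 / \<beta>" "chi (\<sigma> z) = 1 / \<beta>" using F by auto
  show ?thesis
    unfolding exponential_solution_def D z using F c by (auto simp: field_simps)
qed

lemma family6_exponential_solution:
  assumes "family6 \<sigma> z l f g \<alpha> \<delta> b c chi"
  shows "exponential_solution \<sigma> z (\<lambda>x. f x - l * g x) g
    ((\<alpha> * (1 + c) + 2 * b * \<delta>) / (2 * \<delta>)) (- (\<alpha> * (c - 1) + 2 * b * \<delta>) / (2 * \<delta>))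
    ((1 + c) / (2 * \<delta>)) ((1 - c) / (2 * \<delta>)) chi"
proof -
  note F = assms[unfolded family6_def]
  have c: "\<alpha> \<noteq> 0" "\<delta> \<noteq> 0" "b \<noteq> 0" using F by auto
  define P where "P = \<alpha> * (1 + c) + 2 * b * \<delta>"
  define Q where "Q = \<alpha> * (c - 1) + 2 * b * \<delta>"
  \<comment> \<open>The two values excluded for \<alpha> are those at which one of the denominators
    \<open>P\<close>, \<open>Q\<close> vanishes.\<close>
  have "P = \<alpha> - - (2 * b * \<delta> + \<alpha> * c)" "Q = (2 * b * \<delta> + \<alpha> * c) - \<alpha>"
    by (simp_all add: P_def Q_def algebra_simps)
  then have PQ: "P \<noteq> 0" "Q \<noteq> 0"
    using F by (simp_all only: right_minus_eq) auto
  have z: "chi z = 2 * b / P" "chi (\<sigma> z) = 2 * b / Q" using F by (auto simp: P_def Q_def)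
  have D: "P / (2 * \<delta>) * ((1 - c) / (2 * \<delta>)) - - Q / (2 * \<delta>) * ((1 + c) / (2 * \<delta>)) = b / \<delta>"
    unfolding P_def Q_def using c(2) by (simp add: field_simps)
  have "f x - l * g x = P / (2 * \<delta>) * chi x + - Q / (2 * \<delta>) * chi (\<sigma> x)" for x
    using F c unfolding P_def Q_def by (simp add: field_simps)
  then show ?thesis
    unfolding exponential_solution_def D z P_def[symmetric] Q_def[symmetric]
    using F c PQ by (auto simp: field_simps)
qed

lemma exponential_solution_families:
  assumes "exponential_solution \<sigma> z (\<lambda>x. f x - l * g x) g p q r s chi"
  shows "(\<exists>\<gamma> b c chi. family4 \<sigma> z l f g \<gamma> b c chi) \<or> (\<exists>\<beta> b c chi. family5 \<sigma> z l f g \<beta> b c chi)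
    \<or> (\<exists>\<alpha> \<delta> b c chi. family6 \<sigma> z l f g \<alpha> \<delta> b c chi)"
proof -
  note F = assms[unfolded exponential_solution_def]
  have chi: "exponential chi" "chi \<noteq> chi \<circ> \<sigma>" using F by auto
  define D where "D = p * s - q * r"
  have D: "D \<noteq> 0" and z: "p * chi z = D" "q * chi (\<sigma> z) = - D" using F by (auto simp: D_def)
  then have pq: "p \<noteq> 0" "q \<noteq> 0" by auto
  have z': "chi z = D / p" "chi (\<sigma> z) = - D / q"
    using z pq by (simp_all add: field_simps)
  have g: "g x = r * chi x + s * chi (\<sigma> x)" for x using F by auto
  have "f x - l * g x = p * chi x + q * chi (\<sigma> x)" for x using F by auto
  then have f: "f x = p * chi x + q * chi (\<sigma> x) + l * (r * chi x + s * chi (\<sigma> x))" for x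
    unfolding g by (simp add: algebra_simps)
  have scale: "u = v / (2 * d)" if "d \<noteq> 0" "2 * d * u = v" for d u v :: complex
    using that by (auto simp: field_simps)
  consider "r + s = 0" | "r + s \<noteq> 0" "p + q = 0" | "r + s \<noteq> 0" "p + q \<noteq> 0" by blast
  then show ?thesis
  proof cases
    case 1
    then have s: "s = - r" by (simp add: add_eq_0_iff)
    have D': "D = - r * (p + q)" by (simp add: D_def s algebra_simps)
    with D have nz: "r \<noteq> 0" "p + q \<noteq> 0" by auto
    \<comment> \<open>As \<open>r + s = 0\<close>, the coefficient of
      \<open>chi + chi \<circ> \<sigma>\<close> in \<open>f\<close> is \<open>(p + q) / 2\<close>,
      which has to be \<open>1 / (2 * \<gamma>)\<close>.\<close>
    define \<gamma> where "\<gamma> = 1 / (p + q)"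
    have \<gamma>: "\<gamma> \<noteq> 0" "(p + q) * \<gamma> = 1" using nz by (auto simp: \<gamma>_def)
    define c where "c = (p - q) * \<gamma>"
    have c: "1 + c = 2 * p * \<gamma>" "1 - c = 2 * q * \<gamma>"
      using \<gamma>(2) unfolding c_def by algebra+
    have "family4 \<sigma> z l f g \<gamma> r c chi"
      unfolding family4_def c
    proof (intro conjI ext)
      show "c \<noteq> 1" "c \<noteq> - 1" using c pq \<gamma> by auto
      have "(2 * p * \<gamma>) * chi z = - 2 * r"
        using z(1) \<gamma>(2) unfolding D' by algebra
      then show "chi z = - 2 * r / (2 * p * \<gamma>)"
        using pq \<gamma> by (simp add: field_simps)
      have "(2 * q * \<gamma>) * chi (\<sigma> z) = 2 * r"
        using z(2) \<gamma>(2) unfolding D' by algebra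
      then show "(chi \<circ> \<sigma>) z = 2 * r / (2 * q * \<gamma>)"
        using pq \<gamma> by (simp add: field_simps)
      have "2 * \<gamma> * f x = (chi x + chi (\<sigma> x)) + (2 * \<gamma> * l * r + c) * (chi x - chi (\<sigma> x))" for x
        using \<gamma>(2) unfolding c_def f s by algebra
      from scale[OF \<gamma>(1) this]
      show "f x = (chi x + (chi \<circ> \<sigma>) x) / (2 * \<gamma>)
          + (2 * \<gamma> * l * r + c) * ((chi x - (chi \<circ> \<sigma>) x) / (2 * \<gamma>))" for x
        by (simp only: comp_apply times_divide_eq_right add_divide_distrib[symmetric])
      show "g x = r * (chi x - (chi \<circ> \<sigma>) x)" for x
        unfolding g s by (simp add: algebra_simps)
    qed (use nz \<gamma> chi in auto)
    then show ?thesis by blast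
  next
    case 2
    then have q: "q = - p" by (simp add: add_eq_0_iff)
    have D': "D = p * (r + s)" by (simp add: D_def q algebra_simps)
    define \<beta> where "\<beta> = 1 / (r + s)"
    have \<beta>: "\<beta> \<noteq> 0" "(r + s) * \<beta> = 1" using 2 by (auto simp: \<beta>_def)
    define c where "c = (r - s) * \<beta>"
    have "family5 \<sigma> z l f g \<beta> p c chi"
      unfolding family5_def
    proof (intro conjI ext)
      show "chi z = 1 / \<beta>" "(chi \<circ> \<sigma>) z = 1 / \<beta>"
        using pq by (simp_all add: z' D' q \<beta>_def)
      have "2 * \<beta> * f x = l * (chi x + chi (\<sigma> x)) + (2 * \<beta> * p + l * c) * (chi x - chi (\<sigma> x))" for x
        using \<beta>(2) unfolding c_def f q by algebra
      from scale[OF \<beta>(1) this]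
      show "f x = l * ((chi x + (chi \<circ> \<sigma>) x) / (2 * \<beta>))
          + (2 * \<beta> * p + l * c) * ((chi x - (chi \<circ> \<sigma>) x) / (2 * \<beta>))" for x
        by (simp only: comp_apply times_divide_eq_right add_divide_distrib[symmetric])
      have "2 * \<beta> * g x = chi x + chi (\<sigma> x) + c * (chi x - chi (\<sigma> x))" for x
        using \<beta>(2) unfolding c_def g by algebra
      from scale[OF \<beta>(1) this]
      show "g x = (chi x + (chi \<circ> \<sigma>) x) / (2 * \<beta>) + c * ((chi x - (chi \<circ> \<sigma>) x) / (2 * \<beta>))" for x
        by (simp only: comp_apply times_divide_eq_right add_divide_distrib[symmetric])
    qed (use \<beta> chi pq in auto)
    then show ?thesis by blast
  next
    case 3
    \<comment> \<open>Here \<delta> normalises the even part of \<open>g\<close> and \<alpha> is the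
      ratio of the even parts of \<open>f - l * g\<close> and \<open>g\<close>. Taking
      \<open>b\<close> to be the determinant times \<delta> turns the denominators of the family
      into \<open>2 * \<delta> * p\<close> and \<open>- (2 * \<delta> * q)\<close>.\<close>
    define \<delta> where "\<delta> = 1 / (r + s)"
    have \<delta>: "\<delta> \<noteq> 0" "(r + s) * \<delta> = 1" using 3 by (auto simp: \<delta>_def)
    define \<alpha> where "\<alpha> = (p + q) * \<delta>"
    define b where "b = D * \<delta>"
    define c where "c = (r - s) * \<delta>"
    have P: "\<alpha> * (1 + c) + 2 * b * \<delta> = 2 * \<delta> * p" and Q: "\<alpha> * (c - 1) + 2 * b * \<delta> = - (2 * \<delta> * q)"
      using \<delta>(2) unfolding \<alpha>_def b_def c_def D_def by algebra+
    have "family6 \<sigma> z l f g \<alpha> \<delta> b c chi"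
      unfolding family6_def P Q
    proof (intro conjI ext)
      show "\<alpha> \<noteq> 0" "b \<noteq> 0" using 3 \<delta> D by (auto simp: \<alpha>_def b_def)
      show "\<alpha> \<noteq> 2 * b * \<delta> + \<alpha> * c"
      proof
        assume "\<alpha> = 2 * b * \<delta> + \<alpha> * c"
        with Q have "2 * \<delta> * q = 0" by algebra
        with pq \<delta> show False by simp
      qed
      show "\<alpha> \<noteq> - (2 * b * \<delta> + \<alpha> * c)"
      proof
        assume "\<alpha> = - (2 * b * \<delta> + \<alpha> * c)"
        with P have "2 * \<delta> * p = 0" by algebra
        with pq \<delta> show False by simp
      qed
      show "chi z = 2 * b / (2 * \<delta> * p)" "(chi \<circ> \<sigma>) z = 2 * b / - (2 * \<delta> * q)"
        using \<delta> pq by (simp_all add: z' b_def field_simps)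
      have "2 * \<delta> * f x = (\<alpha> + l) * (chi x + chi (\<sigma> x)) + (c * (\<alpha> + l) + 2 * b * \<delta>) * (chi x - chi (\<sigma> x))" for x
        using \<delta>(2) unfolding \<alpha>_def b_def c_def D_def f by algebra
      from scale[OF \<delta>(1) this] show "f x = (\<alpha> + l) * ((chi x + (chi \<circ> \<sigma>) x) / (2 * \<delta>)) +
         (c * (\<alpha> + l) + 2 * b * \<delta>) * ((chi x - (chi \<circ> \<sigma>) x) / (2 * \<delta>))" for x
        by (simp only: comp_apply times_divide_eq_right add_divide_distrib[symmetric])
      have "2 * \<delta> * g x = chi x + chi (\<sigma> x) + c * (chi x - chi (\<sigma> x))" for x
        using \<delta>(2) unfolding c_def g by algebra
      from scale[OF \<delta>(1) this] show "g x = (chi x + (chi \<circ> \<sigma>) x) / (2 * \<delta>) + c * ((chi x - (chi \<circ> \<sigma>) x) / (2 * \<delta>))" for x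
        by (simp only: comp_apply times_divide_eq_right add_divide_distrib[symmetric])
    qed (use \<delta> chi in auto)
    then show ?thesis by blast
  qed
qed

lemma continuous_map_complex_mult:
  fixes u v :: "'a \<Rightarrow> complex"
  assumes "continuous_map T euclidean u" "continuous_map T euclidean v"
  shows "continuous_map T euclidean (\<lambda>x. u x * v x)"
  using assms by (simp add: continuous_map_atin tendsto_mult)

lemma continuous_map_complex_divide:
  fixes u v :: "'a \<Rightarrow> complex"
  assumes "continuous_map T euclidean u" "continuous_map T euclidean v"
    and "\<And>x. x \<in> topspace T \<Longrightarrow> v x \<noteq> 0"
  shows "continuous_map T euclidean (\<lambda>x. u x / v x)"
  using assms by (simp add: continuous_map_atin tendsto_divide)

text \<open>Cramer's rule, with the non-zero coefficient determinant, expresses \<open>chi\<close>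
  and \<open>chi \<circ> \<sigma>\<close> as linear combinations of \<open>h\<close> and
  \<open>g\<close>.\<close>

lemma exponential_solution_continuous:
  assumes "exponential_solution \<sigma> z h g p q r s chi"
    and hc: "continuous_map T euclidean h" and gc: "continuous_map T euclidean g"
  shows "continuous_map T euclidean chi" "continuous_map T euclidean (chi \<circ> \<sigma>)"
proof -
  note F = assms(1)[unfolded exponential_solution_def]
  have D: "p * s - q * r \<noteq> 0" using F by blast
  have h: "h x = p * chi x + q * chi (\<sigma> x)" and g: "g x = r * chi x + s * chi (\<sigma> x)" for x
    using F by auto
  have "chi = (\<lambda>x. (s * h x - q * g x) / (p * s - q * r))"
    using D unfolding h g by (auto simp: fun_eq_iff nonzero_eq_divide_eq) (simp add: algebra_simps)
  moreover have "chi \<circ> \<sigma> = (\<lambda>x. (p * g x - r * h x) / (p * s - q * r))"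
    using D unfolding h g by (auto simp: fun_eq_iff nonzero_eq_divide_eq) (simp add: algebra_simps)
  moreover have "continuous_map T euclidean (\<lambda>x. (s * h x - q * g x) / (p * s - q * r))"
    "continuous_map T euclidean (\<lambda>x. (p * g x - r * h x) / (p * s - q * r))"
    using D by (auto intro!: continuous_map_complex_divide continuous_map_diff continuous_map_complex_mult hc gc)
  ultimately show "continuous_map T euclidean chi" "continuous_map T euclidean (chi \<circ> \<sigma>)"
    by simp_all
qed

section \<open>Solutions built from one exponential and an additive function\<close>

text \<open>
  The common form of families 7 (\<open>r = 0\<close>) and 8 (\<open>r \<noteq> 0\<close>).  The normalisations in these families are
  reached by rescaling \<open>\<Psi>\<close>, that is, \<open>A\<close> and \<open>\<rho>\<close>.
\<close>

definition additive_solution ::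
    "('a::semigroup_mult \<Rightarrow> 'a) \<Rightarrow> 'a \<Rightarrow> ('a \<Rightarrow> complex) \<Rightarrow> ('a \<Rightarrow> complex) \<Rightarrow>
     complex \<Rightarrow> complex \<Rightarrow> complex \<Rightarrow> complex \<Rightarrow>
     ('a \<Rightarrow> complex) \<Rightarrow> ('a \<Rightarrow> complex) \<Rightarrow> ('a \<Rightarrow> complex) \<Rightarrow> bool" where
  "additive_solution \<sigma> z h g p q r s chi A \<rho> \<longleftrightarrow>
     Psi_admissible chi A \<rho> \<and> chi \<circ> \<sigma> = chi \<and>
     (\<forall>x \<in> - null_space chi. A (\<sigma> x) = - A x) \<and> (\<forall>x \<in> P_set chi. \<rho> (\<sigma> x) = - \<rho> x) \<and>
     p * s - q * r \<noteq> 0 \<and> q * chi z = - (p * s - q * r) \<and> q * A z = - p \<and>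
     (\<forall>x. h x = p * chi x + q * Psi chi A \<rho> x) \<and> (\<forall>x. g x = r * chi x + s * Psi chi A \<rho> x)"

text \<open>With \<psi> for \<open>Psi\<close>, the right-hand side is the determinant times
  \<open>chi x * \<psi> y - \<psi> x * chi y\<close>. The condition on \<open>chi z\<close> matches
  this term, and the one on \<open>A z\<close> cancels the remaining multiple of
  \<open>chi x * chi y\<close>.\<close>

lemma additive_solution_solves:
  assumes \<sigma>: "involutive_automorphism \<sigma>" and "additive_solution \<sigma> z h g p q r s chi A \<rho>"
  shows "sine_subtraction \<sigma> z h g"
  unfolding sine_subtraction_def
proof (intro allI)
  fix x y
  note F = assms(2)[unfolded additive_solution_def]
  define \<psi> where "\<psi> = Psi chi A \<rho>"
  have adm: "Psi_admissible chi A \<rho>" using F by blast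
  have mult: "chi (x * y) = chi x * chi y" for x y
    using adm by (simp add: Psi_admissible_def exponential_def multiplicative_def)
  have add: "\<psi> (x * y) = \<psi> x * chi y + chi x * \<psi> y" for x y
    unfolding \<psi>_def by (rule Psi_sine_addition[OF adm])
  have odd: "\<psi> (\<sigma> x) = - \<psi> x" for x
    unfolding \<psi>_def by (rule Psi_odd[OF \<sigma>]) (use F in blast)+
  have even: "chi (\<sigma> x) = chi x" for x
    using F by (metis comp_apply)
  have z: "q * chi z = - (p * s - q * r)" "q * A z = - p" "p * s - q * r \<noteq> 0" using F by blast+
  then have "chi z \<noteq> 0" by auto
  then have \<psi>z: "\<psi> z = A z * chi z" by (simp add: \<psi>_def Psi_def null_space_def)
  have h: "h x = p * chi x + q * \<psi> x" and g: "g x = r * chi x + s * \<psi> x" for x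
    unfolding \<psi>_def using F by blast+
  show "h (x * \<sigma> y * z) = h x * g y - h y * g x"
    unfolding h g mult add odd even \<psi>z using z(1,2) by algebra
qed

lemma family7_additive_solution:
  assumes "family7 \<sigma> z l f g \<gamma> c chi A \<rho>"
  shows "additive_solution \<sigma> z (\<lambda>x. f x - l * g x) g \<gamma> (\<gamma> * c) 0 1 chi A \<rho>"
  using assms unfolding family7_def additive_solution_def
  by (auto simp: algebra_simps)

lemma family8_additive_solution:
  assumes "family8 \<sigma> z l f g \<alpha> c \<delta> chi A \<rho>"
  shows "additive_solution \<sigma> z (\<lambda>x. f x - l * g x) g
    (\<alpha> / \<delta>) ((\<alpha> * c + \<delta>) / \<delta>) (1 / \<delta>) (c / \<delta>) chi A \<rho>"
proof -
  note F = assms[unfolded family8_def]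
  have nz: "\<delta> \<noteq> 0" "\<alpha> * c + \<delta> \<noteq> 0" using F by blast+
  have D: "\<alpha> / \<delta> * (c / \<delta>) - (\<alpha> * c + \<delta>) / \<delta> * (1 / \<delta>) = - 1 / \<delta>"
    using nz(1) by (simp add: field_simps)
  have dn: "- 1 / \<delta> \<noteq> 0" using nz(1) by simp
  have z: "chi z = 1 / (\<alpha> * c + \<delta>)" "A z = - (\<alpha> / (\<alpha> * c + \<delta>))" using F by blast+
  have f': "f x = (\<alpha> + l) / \<delta> * chi x + (c * (l + \<alpha>) + \<delta>) / \<delta> * Psi chi A \<rho> x"
    and g: "g x = 1 / \<delta> * chi x + c / \<delta> * Psi chi A \<rho> x" for x
    using F by (simp_all add: algebra_simps)
  have f: "f x - l * g x = \<alpha> / \<delta> * chi x + (\<alpha> * c + \<delta>) / \<delta> * Psi chi A \<rho> x" for x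
    unfolding f' g using nz(1) by (simp add: field_simps)
  have "(\<alpha> * c + \<delta>) / \<delta> * chi z = - (- 1 / \<delta>)" "(\<alpha> * c + \<delta>) / \<delta> * A z = - (\<alpha> / \<delta>)"
    unfolding z using nz by simp_all
  then show ?thesis
    unfolding additive_solution_def D using F f g dn by blast
qed

text \<open>Cramer's rule gives continuity of \<open>chi\<close> and of \<open>Psi\<close>. Then
  \<open>A\<close> is the quotient of \<open>Psi\<close> by \<open>chi\<close> off the null space,
  and \<rho> is the restriction of \<open>Psi\<close> to \<open>P_set chi\<close>.\<close>

lemma additive_solution_continuous:
  assumes "additive_solution \<sigma> z h g p q r s chi A \<rho>"
    and hc: "continuous_map T euclidean h" and gc: "continuous_map T euclidean g"
  shows "continuous_map T euclidean chi" "continuous_map T euclidean (chi \<circ> \<sigma>)"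
    "cont_on T (- null_space chi) A" "cont_on T (P_set chi) \<rho>"
proof -
  note F = assms(1)[unfolded additive_solution_def]
  define \<psi> where "\<psi> = Psi chi A \<rho>"
  have D: "p * s - q * r \<noteq> 0" using F by blast
  have h: "h x = p * chi x + q * \<psi> x" and g: "g x = r * chi x + s * \<psi> x" for x
    unfolding \<psi>_def using F by blast+
  have 1: "chi = (\<lambda>x. (s * h x - q * g x) / (p * s - q * r))"
    using D unfolding h g by (auto simp: fun_eq_iff nonzero_eq_divide_eq) (simp add: algebra_simps)
  have 2: "\<psi> = (\<lambda>x. (p * g x - r * h x) / (p * s - q * r))"
    using D unfolding h g by (auto simp: fun_eq_iff nonzero_eq_divide_eq) (simp add: algebra_simps)
  have "continuous_map T euclidean (\<lambda>x. (s * h x - q * g x) / (p * s - q * r))"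
    "continuous_map T euclidean (\<lambda>x. (p * g x - r * h x) / (p * s - q * r))"
    using D by (auto intro!: continuous_map_complex_divide continuous_map_diff continuous_map_complex_mult hc gc)
  then have chi: "continuous_map T euclidean chi" and \<psi>: "continuous_map T euclidean \<psi>"
    using 1 2 by simp_all
  show "continuous_map T euclidean chi" by (rule chi)
  then show "continuous_map T euclidean (chi \<circ> \<sigma>)" using F by metis
  have "cont_on T (- null_space chi) (\<lambda>x. \<psi> x / chi x)"
    by (intro continuous_map_complex_divide continuous_map_from_subtopology chi \<psi>)
      (auto simp: null_space_def)
  then show "cont_on T (- null_space chi) A"
    by (rule continuous_map_eq) (auto simp: \<psi>_def Psi_def null_space_def)
  have "cont_on T (P_set chi) \<psi>"
    by (intro continuous_map_from_subtopology \<psi>)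
  then show "cont_on T (P_set chi) \<rho>"
    by (rule continuous_map_eq) (auto simp: \<psi>_def Psi_def P_set_def)
qed

section \<open>From the structure of a solution to the families\<close>

lemma sine_subtraction_exponential_case:
  assumes \<sigma>: "involutive_automorphism \<sigma>"
    and eq: "sine_subtraction \<sigma> z h g" and ind: "lin_indep h g"
    and mult: "multiplicative chi"
    and h: "\<And>x. h x = p * chi x + q * chi (\<sigma> x)" and g: "\<And>x. g x = r * chi x + s * chi (\<sigma> x)"
  shows "exponential_solution \<sigma> z h g p q r s chi"
proof -
  have \<sigma>mult: "\<sigma> (x * y) = \<sigma> x * \<sigma> y" and \<sigma>\<sigma>: "\<sigma> (\<sigma> x) = x" for x y
    using \<sigma> by (auto simp: involutive_automorphism_def)
  have m: "chi (x * y) = chi x * chi y" for x y using mult by (simp add: multiplicative_def)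
  have E: "h (x * \<sigma> y * z) = h x * g y - h y * g x" for x y
    using eq by (simp add: sine_subtraction_def)
  have ind': "lin_indep chi (\<lambda>x. chi (\<sigma> x))"
    using lin_indep_of_combination[OF ind h g] .
  have D: "p * s - q * r \<noteq> 0" using lin_indep_combination_det[OF ind h g] .
  obtain y where y: "chi y \<noteq> 0"
    using lin_indepD(1)[OF ind', of 1 0] by auto
  have ne: "chi \<noteq> chi \<circ> \<sigma>"
  proof
    assume "chi = chi \<circ> \<sigma>"
    then have "chi (\<sigma> x) = chi x" for x by (metis comp_apply)
    then show False using lin_indepD(1)[OF ind', of 1 "-1"] by simp
  qed
  \<comment> \<open>For fixed \<open>w\<close> this is a linear relation between the independent
    functions \<open>chi\<close> and \<open>chi \<circ> \<sigma>\<close>. Taking \<open>w\<close> to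
    be \<open>y\<close> or \<open>\<sigma> y\<close>, with \<open>chi y\<close> non-zero, isolates
    the two conditions at \<open>z\<close>.\<close>
  have *: "(p * chi z - (p * s - q * r)) * chi (\<sigma> w) * chi x
      + (q * chi (\<sigma> z) + (p * s - q * r)) * chi w * chi (\<sigma> x) = 0" for w x
    using E[of x w] unfolding h g m \<sigma>mult \<sigma>\<sigma> by algebra
  have "(q * chi (\<sigma> z) + (p * s - q * r)) * chi y = 0" by (rule lin_indepD(2)[OF ind' *])
  moreover have "(p * chi z - (p * s - q * r)) * chi (\<sigma> (\<sigma> y)) = 0" by (rule lin_indepD(1)[OF ind' *])
  ultimately have "q * chi (\<sigma> z) + (p * s - q * r) = 0" "p * chi z - (p * s - q * r) = 0"
    using y by (simp_all only: mult_eq_0_iff \<sigma>\<sigma> simp_thms)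
  then have z: "p * chi z = p * s - q * r" "q * chi (\<sigma> z) = - (p * s - q * r)"
    by (simp_all only: right_minus_eq add_eq_0_iff2)
  have "exponential chi" using mult y by (auto simp: exponential_def)
  then show ?thesis
    unfolding exponential_solution_def using ne D z h g by blast
qed

text \<open>Comparing coefficients in the independent pair \<open>t\<close>, \<open>n\<close> gives
  the conditions at \<open>z\<close>. The second claim holds because \<open>n\<close> is not
  identically zero and coincides with its \<open>Psi\<close>, so one of the two ingredients of
  \<open>Psi\<close> is non-zero somewhere.\<close>

lemma sine_subtraction_additive_case:
  assumes \<sigma>: "involutive_automorphism \<sigma>"
    and eq: "sine_subtraction \<sigma> z h g" and ind: "lin_indep h g"
    and even: "\<And>x. t (\<sigma> x) = t x" and odd: "\<And>x. n (\<sigma> x) = - n x"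
    and mult: "\<And>x y. t (x * y) = t x * t y"
    and add: "\<And>x y. n (x * y) = t x * n y + n x * t y"
    and h: "\<And>x. h x = p * t x + q * n x" and g: "\<And>x. g x = r * t x + s * n x"
  shows "additive_solution \<sigma> z h g p q r s t (\<lambda>x. n x / t x) n"
    and "(\<exists>x \<in> - null_space t. n x / t x \<noteq> 0) \<or> (\<exists>x \<in> P_set t. n x \<noteq> 0)"
proof -
  have E: "h (x * \<sigma> y * z) = h x * g y - h y * g x" for x y
    using eq by (simp add: sine_subtraction_def)
  have ind': "lin_indep t n" using lin_indep_of_combination[OF ind h g] .
  have D: "p * s - q * r \<noteq> 0" using lin_indep_combination_det[OF ind h g] .
  obtain y where y: "t y \<noteq> 0"
    using lin_indepD(1)[OF ind', of 1 0] by auto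
  have *: "(t w * (p * t z + q * n z) - (q * t z + (p * s - q * r)) * n w) * t x
      + ((q * t z + (p * s - q * r)) * t w) * n x = 0" for w x
    using E[of x w] unfolding h g mult add even odd by algebra
  have "(q * t z + (p * s - q * r)) * t y = 0" by (rule lin_indepD(2)[OF ind' *])
  then have z1: "q * t z + (p * s - q * r) = 0" using y by simp
  have "t y * (p * t z + q * n z) - (q * t z + (p * s - q * r)) * n y = 0"
    by (rule lin_indepD(1)[OF ind' *])
  then have z2: "p * t z + q * n z = 0" using y z1 by simp
  have z1': "q * t z = - (p * s - q * r)" using z1 by (simp only: add_eq_0_iff2)
  with D have tz: "t z \<noteq> 0" by auto
  have z2': "q * (n z / t z) = - p"
    using z2 tz by (simp add: field_simps add_eq_0_iff)
  have "exponential t"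
    using mult y by (auto simp: exponential_def multiplicative_def)
  moreover have "n (x * y) = n x * t y + t x * n y" for x y by (simp add: add)
  ultimately have P: "Psi t (\<lambda>x. n x / t x) n = n" "Psi_admissible t (\<lambda>x. n x / t x) n"
    using sine_addition_Psi[of t n] by blast+
  show "additive_solution \<sigma> z h g p q r s t (\<lambda>x. n x / t x) n"
    unfolding additive_solution_def P(1) using P(2) D z1' z2' even odd h g by (auto simp: fun_eq_iff)
  have "\<exists>x. n x \<noteq> 0" using lin_indepD(2)[OF ind', of 0 1] by auto
  then obtain x where "n x \<noteq> 0" ..
  then show "(\<exists>x \<in> - null_space t. n x / t x \<noteq> 0) \<or> (\<exists>x \<in> P_set t. n x \<noteq> 0)"
    using fun_cong[OF P(1), of x] by (auto simp: Psi_def null_space_def split: if_splits)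
qed

lemma sine_subtraction_independent_families:
  assumes \<sigma>: "involutive_automorphism \<sigma>"
    and eq: "sine_subtraction \<sigma> z (\<lambda>x. f x - l * g x) g"
    and ind: "lin_indep (\<lambda>x. f x - l * g x) g"
  shows "(\<exists>\<gamma> b c chi. family4 \<sigma> z l f g \<gamma> b c chi) \<or> (\<exists>\<beta> b c chi. family5 \<sigma> z l f g \<beta> b c chi)
    \<or> (\<exists>\<alpha> \<delta> b c chi. family6 \<sigma> z l f g \<alpha> \<delta> b c chi)
    \<or> (\<exists>\<gamma> c chi A \<rho>. family7 \<sigma> z l f g \<gamma> c chi A \<rho>)
    \<or> (\<exists>\<alpha> c \<delta> chi A \<rho>. family8 \<sigma> z l f g \<alpha> c \<delta> chi A \<rho>)"
proof -
  define h where "h x = f x - l * g x" for x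
  have eq': "sine_subtraction \<sigma> z h g" and ind': "lin_indep h g"
    using eq ind by (simp_all add: h_def[abs_def])
  show ?thesis
  proof (rule sine_subtraction_structure[OF \<sigma> eq' ind'])
    fix t n and \<nu> p q r s :: complex
    assume even: "\<And>x. t (\<sigma> x) = t x" and odd: "\<And>x. n (\<sigma> x) = - n x"
      and t: "\<And>x y. t (x * y) = t x * t y + \<nu> * n x * n y"
      and n: "\<And>x y. n (x * y) = t x * n y + n x * t y"
      and h: "\<And>x. h x = p * t x + q * n x" and g: "\<And>x. g x = r * t x + s * n x"
  show ?thesis
  proof (cases "\<nu> = 0")
    case False
    \<comment> \<open>The matrix \<open>t x I + n x N\<close> has the eigenvalues
      \<open>t x + \<mu> * n x\<close> and \<open>t x - \<mu> * n x\<close>; the parity of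
      \<open>t\<close> and \<open>n\<close> makes \<sigma> interchange them.\<close>
    define \<mu> where "\<mu> = csqrt \<nu>"
    have \<mu>: "\<mu> * \<mu> = \<nu>" "\<mu> \<noteq> 0"
      using False by (auto simp: \<mu>_def simp flip: power2_eq_square)
    define chi where "chi x = t x + \<mu> * n x" for x
    have "chi (x * y) = chi x * chi y" for x y
      unfolding chi_def t n \<mu>(1)[symmetric] by (simp add: algebra_simps)
    then have mult: "multiplicative chi" by (simp add: multiplicative_def)
    have tn: "t x = (chi x + chi (\<sigma> x)) / 2" "n x = (chi x - chi (\<sigma> x)) / (2 * \<mu>)" for x
      using \<mu>(2) by (simp_all add: chi_def even odd)
    have comb: "u * t x + v * n x = (u / 2 + v / (2 * \<mu>)) * chi x + (u / 2 - v / (2 * \<mu>)) * chi (\<sigma> x)"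
      for u v x
      unfolding tn using \<mu>(2) by (simp add: field_simps)
    have "exponential_solution \<sigma> z h g (p / 2 + q / (2 * \<mu>)) (p / 2 - q / (2 * \<mu>))
        (r / 2 + s / (2 * \<mu>)) (r / 2 - s / (2 * \<mu>)) chi"
      by (rule sine_subtraction_exponential_case[OF \<sigma> eq' ind' mult]) (simp_all only: h g comb)
    from exponential_solution_families[OF this[unfolded h_def[abs_def]]] show ?thesis
      by (elim disjE) simp_all
  next
    case True
    have mult: "t (x * y) = t x * t y" for x y using t True by simp
    \<comment> \<open>Replacing \<open>n\<close> by \<open>k * n\<close> and dividing its
      coefficients by \<open>k\<close> leaves \<open>h\<close> and \<open>g\<close> unchanged; this
      freedom is used below to reach the normal forms.\<close>
    have sol: "additive_solution \<sigma> z h g p (q / k) r (s / k) t (\<lambda>x. k * n x / t x) (\<lambda>x. k * n x)"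
      and nonzero: "(\<exists>x \<in> - null_space t. k * n x / t x \<noteq> 0) \<or> (\<exists>x \<in> P_set t. k * n x \<noteq> 0)"
      if "k \<noteq> 0" for k
      using that
      by (intro sine_subtraction_additive_case[OF \<sigma> eq' ind', where n = "\<lambda>x. k * n x"
            and p = p and q = "q / k" and r = r and s = "s / k"];
          simp add: even odd mult n h g algebra_simps)+
    have D: "p * s - q * r \<noteq> 0" using lin_indep_combination_det[OF ind' h g] .
    have f: "f x = h x + l * g x" for x by (simp add: h_def)
    show ?thesis
    proof (cases "r = 0")
      case r: True
      then have nz: "p \<noteq> 0" "s \<noteq> 0" using D by auto
      \<comment> \<open>The scale \<open>k = s\<close> makes \<open>g\<close> equal to
        \<open>Psi\<close>.\<close>
      define A where "A x = s * n x / t x" for x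
      define \<rho> where "\<rho> x = s * n x" for x
      have "additive_solution \<sigma> z h g p (q / s) r (s / s) t A \<rho>"
        using sol[OF nz(2)] by (simp add: A_def[abs_def] \<rho>_def[abs_def])
      note S = this[unfolded additive_solution_def r]
      have q: "q \<noteq> 0" using S nz by auto
      have z: "q * t z = - (p * s)" "q * A z = - (p * s)"
        using S nz by (simp_all add: field_simps)
      have hg: "h x = p * t x + q / s * Psi t A \<rho> x" "g x = Psi t A \<rho> x" for x
        using S nz by simp_all
      have z': "t z = - 1 / (q / (s * p))" "A z = - 1 / (q / (s * p))"
        using z q nz by (simp_all add: field_simps)
      have "A z \<noteq> 0" "t z \<noteq> 0" using z q nz by auto
      then have "\<exists>x \<in> - null_space t. A x \<noteq> 0" by (auto simp: null_space_def)
      moreover have "f = (\<lambda>x. p * t x + (p * (q / (s * p)) + l) * Psi t A \<rho> x)"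
        using nz by (simp add: fun_eq_iff f hg field_simps)
      moreover have "g = Psi t A \<rho>" by (simp add: fun_eq_iff hg)
      ultimately have "family7 \<sigma> z l f g p (q / (s * p)) t A \<rho>"
        unfolding family7_def using S nz q z' by simp
      then show ?thesis by blast
    next
      case r: False
      \<comment> \<open>With \<alpha>, \<delta> and \<open>c\<close> as defined below, the
        coefficient of \<open>Psi\<close> in \<open>h\<close> must be
        \<open>(\<alpha> * c + \<delta>) / \<delta>\<close>, that is
        \<open>q / k = p * s / (k * r) + 1\<close>. Solving for \<open>k\<close> gives this
        value.\<close>
      define k where "k = (q * r - p * s) / r"
      have k: "k \<noteq> 0" "r * k = q * r - p * s" using r D by (auto simp: k_def)
      define A where "A x = k * n x / t x" for x
      define \<rho> where "\<rho> x = k * n x" for x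
      define \<delta> where "\<delta> = 1 / r"
      define \<alpha> where "\<alpha> = p / r"
      define c where "c = s / (k * r)"
      have \<delta>: "\<delta> \<noteq> 0" "r = 1 / \<delta>" using r by (auto simp: \<delta>_def)
      have p: "p = \<alpha> / \<delta>" and s: "s / k = c / \<delta>"
        using r k by (simp_all add: \<alpha>_def \<delta>_def c_def)
      have q: "q / k = (\<alpha> * c + \<delta>) / \<delta>"
      proof -
        have "q * r = k * r + p * s" using k(2) by (simp add: algebra_simps)
        then have "q = (k * r + p * s) / r" using r by (simp add: nonzero_eq_divide_eq)
        then show ?thesis
          unfolding \<alpha>_def \<delta>_def c_def \<open>q = _\<close> using r k(1) by (simp add: field_simps)
      qed
      have "additive_solution \<sigma> z h g (\<alpha> / \<delta>) ((\<alpha> * c + \<delta>) / \<delta>) (1 / \<delta>) (c / \<delta>) t A \<rho>"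
        using sol[OF k(1)] unfolding q s unfolding p \<delta>(2) A_def[abs_def] \<rho>_def[abs_def] .
      note S = this[unfolded additive_solution_def]
      have "\<alpha> / \<delta> * (c / \<delta>) - (\<alpha> * c + \<delta>) / \<delta> * (1 / \<delta>) = - (1 / \<delta>)"
        using \<delta>(1) by (simp add: field_simps)
      moreover have "(\<alpha> * c + \<delta>) / \<delta> * t z = - (\<alpha> / \<delta> * (c / \<delta>) - (\<alpha> * c + \<delta>) / \<delta> * (1 / \<delta>))"
        and Az: "(\<alpha> * c + \<delta>) / \<delta> * A z = - (\<alpha> / \<delta>)"
        using S by blast+
      ultimately have "(\<alpha> * c + \<delta>) / \<delta> * t z = 1 / \<delta>" by (simp only: minus_minus)
      with Az have z: "(\<alpha> * c + \<delta>) * t z = 1" "(\<alpha> * c + \<delta>) * A z = - \<alpha>"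
        using \<delta>(1) by (simp_all only: times_divide_eq_left minus_divide_left divide_cancel_right simp_thms)
      then have nz: "\<alpha> * c + \<delta> \<noteq> 0" by auto
      have z': "t z = 1 / (\<alpha> * c + \<delta>)" "A z = - (\<alpha> / (\<alpha> * c + \<delta>))"
        using z nz
        by (simp_all only: minus_divide_left nonzero_eq_divide_eq mult.commute not_False_eq_True)
      have hg: "h x = \<alpha> / \<delta> * t x + (\<alpha> * c + \<delta>) / \<delta> * Psi t A \<rho> x"
        "g x = 1 / \<delta> * t x + c / \<delta> * Psi t A \<rho> x" for x
        using S by blast+
      have "f = (\<lambda>x. (\<alpha> + l) / \<delta> * t x + (c * (l + \<alpha>) + \<delta>) / \<delta> * Psi t A \<rho> x)"
        using \<delta>(1) by (simp add: fun_eq_iff f hg field_simps)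
      moreover have "g = (\<lambda>x. 1 / \<delta> * (t x + c * Psi t A \<rho> x))"
        by (simp add: fun_eq_iff hg algebra_simps)
      moreover have "(\<exists>x \<in> - null_space t. A x \<noteq> 0) \<or> (\<exists>x \<in> P_set t. \<rho> x \<noteq> 0)"
        using nonzero[OF k(1)] unfolding A_def \<rho>_def .
      ultimately have "family8 \<sigma> z l f g \<alpha> c \<delta> t A \<rho>"
        unfolding family8_def using S \<delta>(1) nz z' by blast
      then show ?thesis by blast
    qed
  qed
  qed
qed

section \<open>The dependent case and the classification\<close>

lemma solves_iff_sine_subtraction:
  "solves \<sigma> z l f g \<longleftrightarrow> sine_subtraction \<sigma> z (\<lambda>x. f x - l * g x) g"
  by (simp add: solves_def sine_subtraction_def algebra_simps)

lemma vanishing_imp_sine_subtraction: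
  assumes "\<forall>x \<in> S2z z. h x = 0" and "\<And>x. g x = k * h x"
  shows "sine_subtraction \<sigma> z h g"
  using assms by (auto simp: sine_subtraction_def S2z_def)

text \<open>For proportional \<open>h\<close> and \<open>g\<close> the right-hand side cancels, and
  replacing \<open>y\<close> by \<open>\<sigma> y\<close> reaches every product
  \<open>x * y * z\<close>.\<close>

lemma sine_subtraction_dependent_vanishes:
  assumes \<sigma>: "involutive_automorphism \<sigma>" and "sine_subtraction \<sigma> z h g" and "\<And>x. g x = k * h x"
  shows "\<forall>x \<in> S2z z. h x = 0"
proof -
  have "h (x * y * z) = 0" for x y
    using assms(2)[unfolded sine_subtraction_def, rule_format, of x "\<sigma> y"] \<sigma>
    by (simp add: assms(3) involutive_automorphism_def)
  then show ?thesis by (auto simp: S2z_def)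
qed

text \<open>The continuity claim covers every choice of parameters representing the given pair, not
  merely one such choice.\<close>

theorem theorem6p1:
  fixes z\<^sub>0 :: "'a::semigroup_mult"
    and \<sigma> :: "'a \<Rightarrow> 'a"
    and l :: complex
    and f g :: "'a \<Rightarrow> complex"
  assumes "involutive_automorphism \<sigma>"
    and "l \<noteq> 0"
  shows "(solves \<sigma> z\<^sub>0 l f g \<longleftrightarrow>
      f = (\<lambda>x. l * g x)
    \<or> (UNIV \<noteq> S2z z\<^sub>0 \<and> g = (\<lambda>x. 0) \<and> f \<noteq> (\<lambda>x. 0) \<and> (\<forall>x \<in> S2z z\<^sub>0. f x = 0))
    \<or> (UNIV \<noteq> S2z z\<^sub>0 \<and> (\<exists>\<kappa>. \<kappa> \<noteq> 0 \<and> f = (\<lambda>x. (1 + \<kappa> * l) / \<kappa> * g x))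
         \<and> g \<noteq> (\<lambda>x. 0) \<and> (\<forall>x \<in> S2z z\<^sub>0. g x = 0))
    \<or> (\<exists>\<gamma> b c chi. family4 \<sigma> z\<^sub>0 l f g \<gamma> b c chi)
    \<or> (\<exists>\<beta> b c chi. family5 \<sigma> z\<^sub>0 l f g \<beta> b c chi)
    \<or> (\<exists>\<alpha> \<delta> b c chi. family6 \<sigma> z\<^sub>0 l f g \<alpha> \<delta> b c chi)
    \<or> (\<exists>\<gamma> c chi A \<rho>. family7 \<sigma> z\<^sub>0 l f g \<gamma> c chi A \<rho>)
    \<or> (\<exists>\<alpha> c \<delta> chi A \<rho>. family8 \<sigma> z\<^sub>0 l f g \<alpha> c \<delta> chi A \<rho>))
  \<and> (\<forall>T. topological_semigroup T \<and> continuous_map T euclidean f \<and> continuous_map T euclidean g \<longrightarrow>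
      (\<forall>\<gamma> b c chi. family4 \<sigma> z\<^sub>0 l f g \<gamma> b c chi \<longrightarrow>
         continuous_map T euclidean chi \<and> continuous_map T euclidean (chi \<circ> \<sigma>))
    \<and> (\<forall>\<beta> b c chi. family5 \<sigma> z\<^sub>0 l f g \<beta> b c chi \<longrightarrow>
         continuous_map T euclidean chi \<and> continuous_map T euclidean (chi \<circ> \<sigma>))
    \<and> (\<forall>\<alpha> \<delta> b c chi. family6 \<sigma> z\<^sub>0 l f g \<alpha> \<delta> b c chi \<longrightarrow>
         continuous_map T euclidean chi \<and> continuous_map T euclidean (chi \<circ> \<sigma>))
    \<and> (\<forall>\<gamma> c chi A \<rho>. family7 \<sigma> z\<^sub>0 l f g \<gamma> c chi A \<rho> \<longrightarrow>
         continuous_map T euclidean chi \<and> continuous_map T euclidean (chi \<circ> \<sigma>)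
         \<and> cont_on T (- null_space chi) A \<and> cont_on T (P_set chi) \<rho>)
    \<and> (\<forall>\<alpha> c \<delta> chi A \<rho>. family8 \<sigma> z\<^sub>0 l f g \<alpha> c \<delta> chi A \<rho> \<longrightarrow>
         continuous_map T euclidean chi \<and> continuous_map T euclidean (chi \<circ> \<sigma>)
         \<and> cont_on T (- null_space chi) A \<and> cont_on T (P_set chi) \<rho>))"
    (is "(?lhs \<longleftrightarrow> ?rhs) \<and> ?top")
proof (intro conjI iffI)
  note \<sigma> = assms(1)
  define h where "h = (\<lambda>x. f x - l * g x)"
  have f: "f x = h x + l * g x" for x by (simp add: h_def)
  have solves: "?lhs \<longleftrightarrow> sine_subtraction \<sigma> z\<^sub>0 h g"
    unfolding h_def by (rule solves_iff_sine_subtraction)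
  {
    assume ?lhs
    then have eq: "sine_subtraction \<sigma> z\<^sub>0 h g" using solves by blast
    consider "\<And>x. h x = 0" | w where "h w \<noteq> 0" "\<And>x. g x = 0"
      | w v where "h w \<noteq> 0" "g v \<noteq> 0" "\<not> lin_indep h g" | "lin_indep h g"
      by blast
    then show ?rhs
    proof cases
      case 1
      then have "f = (\<lambda>x. l * g x)" by (simp add: fun_eq_iff f)
      then show ?thesis by blast
    next
      case 2
      have "\<forall>x \<in> S2z z\<^sub>0. h x = 0"
        by (rule sine_subtraction_dependent_vanishes[OF \<sigma> eq, of 0]) (simp add: 2)
      moreover have "f = h" "g = (\<lambda>x. 0)" using 2(2) by (auto simp: fun_eq_iff f)
      ultimately show ?thesis using 2(1) by (metis UNIV_I)
    next
      case 3
      then obtain p q where pq: "\<And>x. p * h x + q * g x = 0" "p \<noteq> 0 \<or> q \<noteq> 0"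
        unfolding lin_indep_def by blast
      \<comment> \<open>If one coefficient of the relation were zero, the other function would
        vanish identically, against \<open>h w\<close> and \<open>g v\<close> being
        non-zero.\<close>
      have nz: "p \<noteq> 0" "q \<noteq> 0"
        using pq(1)[of w] pq(1)[of v] pq(2) 3(1,2) by auto
      \<comment> \<open>This is the ratio of \<open>g\<close> to \<open>h\<close>, so
        \<open>f = h + l * g\<close> becomes \<open>(1 / \<kappa> + l) * g\<close>.\<close>
      define \<kappa> where "\<kappa> = - p / q"
      have \<kappa>: "\<kappa> \<noteq> 0" "g x = \<kappa> * h x" for x
        using nz pq(1)[of x] by (auto simp: \<kappa>_def field_simps add_eq_0_iff)
      have van: "\<forall>x \<in> S2z z\<^sub>0. h x = 0"
        by (rule sine_subtraction_dependent_vanishes[OF \<sigma> eq \<kappa>(2)])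
      then have "\<forall>x \<in> S2z z\<^sub>0. g x = 0" by (simp add: \<kappa>(2))
      moreover have "UNIV \<noteq> S2z z\<^sub>0" using van 3(1) by (metis UNIV_I)
      moreover have "f = (\<lambda>x. (1 + \<kappa> * l) / \<kappa> * g x)"
        using \<kappa>(1) by (simp add: fun_eq_iff f \<kappa>(2) field_simps)
      moreover have "g \<noteq> (\<lambda>x. 0)" using 3(2) by auto
      ultimately show ?thesis
        using \<kappa>(1) by (intro disjI2[OF disjI2[OF disjI1]] conjI exI[of _ \<kappa>])
    next
      case 4
      then show ?thesis
        using sine_subtraction_independent_families[OF \<sigma>, of z\<^sub>0 f l g] eq unfolding h_def by blast
    qed
  }
  {
    assume ?rhs
    then show ?lhs
      unfolding solves
    proof (elim disjE exE)
      assume "f = (\<lambda>x. l * g x)"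
      then show "sine_subtraction \<sigma> z\<^sub>0 h g" by (simp add: h_def sine_subtraction_def)
    next
      assume "UNIV \<noteq> S2z z\<^sub>0 \<and> g = (\<lambda>x. 0) \<and> f \<noteq> (\<lambda>x. 0) \<and> (\<forall>x \<in> S2z z\<^sub>0. f x = 0)"
      then show "sine_subtraction \<sigma> z\<^sub>0 h g"
        by (intro vanishing_imp_sine_subtraction[of _ _ _ 0]) (simp_all add: h_def)
    next
      assume a: "UNIV \<noteq> S2z z\<^sub>0 \<and> (\<exists>\<kappa>. \<kappa> \<noteq> 0 \<and> f = (\<lambda>x. (1 + \<kappa> * l) / \<kappa> * g x))
         \<and> g \<noteq> (\<lambda>x. 0) \<and> (\<forall>x \<in> S2z z\<^sub>0. g x = 0)"
      then obtain \<kappa> where \<kappa>: "\<kappa> \<noteq> 0" "f = (\<lambda>x. (1 + \<kappa> * l) / \<kappa> * g x)" by blast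
      have "g x = \<kappa> * h x" for x
        using \<kappa>(1) by (simp add: h_def \<kappa>(2) field_simps)
      moreover from this have "\<forall>x \<in> S2z z\<^sub>0. h x = 0" using a \<kappa>(1) by simp
      ultimately show "sine_subtraction \<sigma> z\<^sub>0 h g"
        by (intro vanishing_imp_sine_subtraction)
    qed (unfold h_def,
        (rule exponential_solution_solves[OF \<sigma> family4_exponential_solution]
            exponential_solution_solves[OF \<sigma> family5_exponential_solution]
            exponential_solution_solves[OF \<sigma> family6_exponential_solution]
            additive_solution_solves[OF \<sigma> family7_additive_solution]
            additive_solution_solves[OF \<sigma> family8_additive_solution], assumption)+)
  }
  show ?top
  proof (intro allI impI)
    fix T :: "'a topology"
    assume T: "topological_semigroup T \<and> continuous_map T euclidean f \<and> continuous_map T euclidean g"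
    then have g: "continuous_map T euclidean g"
      and h: "continuous_map T euclidean (\<lambda>x. f x - l * g x)"
      by (auto intro!: continuous_map_diff continuous_map_complex_mult)
    note exponential = exponential_solution_continuous[OF _ h g]
      and additive = additive_solution_continuous[OF _ h g]
    show "(\<forall>\<gamma> b c chi. family4 \<sigma> z\<^sub>0 l f g \<gamma> b c chi \<longrightarrow>
         continuous_map T euclidean chi \<and> continuous_map T euclidean (chi \<circ> \<sigma>))
    \<and> (\<forall>\<beta> b c chi. family5 \<sigma> z\<^sub>0 l f g \<beta> b c chi \<longrightarrow>
         continuous_map T euclidean chi \<and> continuous_map T euclidean (chi \<circ> \<sigma>))
    \<and> (\<forall>\<alpha> \<delta> b c chi. family6 \<sigma> z\<^sub>0 l f g \<alpha> \<delta> b c chi \<longrightarrow>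
         continuous_map T euclidean chi \<and> continuous_map T euclidean (chi \<circ> \<sigma>))
    \<and> (\<forall>\<gamma> c chi A \<rho>. family7 \<sigma> z\<^sub>0 l f g \<gamma> c chi A \<rho> \<longrightarrow>
         continuous_map T euclidean chi \<and> continuous_map T euclidean (chi \<circ> \<sigma>)
         \<and> cont_on T (- null_space chi) A \<and> cont_on T (P_set chi) \<rho>)
    \<and> (\<forall>\<alpha> c \<delta> chi A \<rho>. family8 \<sigma> z\<^sub>0 l f g \<alpha> c \<delta> chi A \<rho> \<longrightarrow>
         continuous_map T euclidean chi \<and> continuous_map T euclidean (chi \<circ> \<sigma>)
         \<and> cont_on T (- null_space chi) A \<and> cont_on T (P_set chi) \<rho>)"
      by (intro conjI allI impI;
          (drule family4_exponential_solution family5_exponential_solution family6_exponential_solution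
            family7_additive_solution family8_additive_solution,
           blast intro: exponential additive))
  qed
qed

end
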